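(* Let $k\geq t+2\geq 4$ and $n\geq t+(k-t)\cdot\max\{18(t+2),\,2ek\}$. If $\mathcal{F},\mathcal{G}\subseteq\binom{[n]}{k}$ are cross $t$-intersecting, then $$\min\{\gamma_t(\mathcal{F}),\gamma_t(\mathcal{G})\}\leq\gamma_t(\mathcal{A}(n,k,t)).$$ If equality holds, then $\mathcal{F},\mathcal{G}\subseteq\mathcal{A}(Z)$ for some $Z\in\binom{[n]}{t+2}$.
   Context: $n,k,t$ are positive integers, $[n]=\{1,\dots,n\}$, $\binom{[n]}{k}$ is the family of all $k$-subsets of $[n]$, and $e$ is the base of the natural logarithm. Families $\mathcal{F},\mathcal{G}$ are cross $t$-intersecting if $|F\cap G|\ge t$ for all $F\in\mathcal{F}$, $G\in\mathcal{G}$. For a family $\mathcal{F}$ of subsets of $[n]$, $\Delta_t(\mathcal{F})=\max\{|\{F\in\mathcal{F}:S\subseteq F\}|:S\in\binom{[n]}{t}\}$ and the $t$-diversity is $\gamma_t(\mathcal{F}):=|\mathcal{F}|-\Delta_t(\mathcal{F})$. For $Z\in\binom{[n]}{t+2}$, $\mathcal{A}(Z)=\{F\in\binom{[n]}{k}:|F\cap Z|\geq t+1\}$, and $\mathcal{A}(n,k,t)=\mathcal{A}([t+2])$; one has $\gamma_t(\mathcal{A}(n,k,t))=t\binom{n-t-2}{k-t-1}$. *)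

theory Defs
  imports Complex_Main "HOL-Library.Ramsey"
begin

text \<open>
  The ground set is \<open>{1..n}\<close>, and its \<open>k\<close>-subsets form the library family \<open>nsets {1..n} k\<close>.
\<close>

definition cross_intersecting :: "nat \<Rightarrow> nat set set \<Rightarrow> nat set set \<Rightarrow> bool" where
  "cross_intersecting t \<F> \<G> \<longleftrightarrow> (\<forall>F\<in>\<F>. \<forall>G\<in>\<G>. t \<le> card (F \<inter> G))"

text \<open>
  The maximum below is over a finite set, nonempty as soon as \<open>t \<le> n\<close>; outside that range
  \<open>max_degree\<close> is unspecified.
\<close>

definition max_degree :: "nat \<Rightarrow> nat \<Rightarrow> nat set set \<Rightarrow> nat" where
  "max_degree n t \<F> = Max ((\<lambda>S. card {F \<in> \<F>. S \<subseteq> F}) ` nsets {1..n} t)"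

text \<open>
  The natural-number subtraction does not truncate for \<open>t \<le> n\<close> and a family \<open>\<F>\<close> of
  subsets of \<open>{1..n}\<close>, because every degree is then at most \<open>card \<F>\<close>.
\<close>

definition diversity :: "nat \<Rightarrow> nat \<Rightarrow> nat set set \<Rightarrow> nat" where
  "diversity n t \<F> = card \<F> - max_degree n t \<F>"

definition frankl_on :: "nat \<Rightarrow> nat \<Rightarrow> nat \<Rightarrow> nat set \<Rightarrow> nat set set" where
  "frankl_on n k t Z = {F \<in> nsets {1..n} k. t + 1 \<le> card (F \<inter> Z)}"

definition frankl :: "nat \<Rightarrow> nat \<Rightarrow> nat \<Rightarrow> nat set set" where
  "frankl n k t = frankl_on n k t {1..t + 2}"

end

theory Submission
  imports Defs
begin

text \<open>
  Peel the families layer by layer. Suppose \<open>\<A>\<close>, \<open>\<B>\<close> are cross \<open>t\<close>-intersecting with members of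
  size at most \<open>t + m\<close>, and call a \<open>(t + m)\<close>-set critical if it meets every member of the other
  family in at least \<open>t\<close> points but no proper subset of it does. A branching argument yields at most
  \<open>((t + m) choose t) * (m + 1) ^ m\<close> critical sets: a partial set \<open>P\<close> meets some member \<open>G\<close> in
  only \<open>t - i\<close> points, and extending it costs a choice of \<open>i\<close> out of at most \<open>m + i\<close> points of
  \<open>G - P\<close>. Discarding the critical sets and descending to \<open>m = 1\<close> loses, for \<open>x = (k - t) / (n - t)\<close>,
  at most \<open>0.31 (t + 1) x ((n - t) choose (k - t))\<close> members of each family, because the losses decay
  geometrically once \<open>e k x \<le> 1/2\<close>, whereas the Frankl family has diversity about
  \<open>t x ((n - t) choose (k - t))\<close>.

  What remains is generated by cross \<open>t\<close>-intersecting families of sets of size at most \<open>t + 1\<close>. Either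
  in one of them all sets but at most one contain a suitable \<open>t\<close>-set, and the corresponding diversity is too
  small, or both consist of \<open>(t + 1)\<close>-subsets of a common \<open>(t + 2)\<close>-set \<open>Z\<close>. In the latter case a
  single member of one family with fewer than \<open>t + 1\<close> points in \<open>Z\<close> cuts the diversity of the
  other one down to a fraction.
\<close>

subsection \<open>Critical transversals and peeling\<close>

definition critical :: "nat \<Rightarrow> 'a set set \<Rightarrow> 'a set \<Rightarrow> bool" where
  "critical t \<B> T \<longleftrightarrow> finite T \<and> (\<forall>G\<in>\<B>. t \<le> card (T \<inter> G)) \<and>
    (\<forall>X. X \<subset> T \<longrightarrow> (\<exists>G\<in>\<B>. card (X \<inter> G) < t))"

text \<open>Here \<open>r\<close> counts the points still to be added to a partial transversal
  \<open>P\<close>; fixing the size relative to \<open>P\<close> makes the branching an induction on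
  \<open>r\<close>.\<close>

definition critical_over :: "nat \<Rightarrow> 'a set set \<Rightarrow> 'a set \<Rightarrow> nat \<Rightarrow> 'a set set" where
  "critical_over t \<B> P r = {T. critical t \<B> T \<and> P \<subseteq> T \<and> card T = card P + r}"

text \<open>Raising \<open>i\<close> by one multiplies the binomial by
  \<open>(m + i + 1) / (i + 1)\<close>, which is at most \<open>m + 1\<close>. This turns the choice
  of \<open>i\<close> points into a cost of \<open>m + 1\<close> per point.\<close>

lemma binomial_le_power: "(m + i) choose i \<le> (m + 1) ^ i"
proof (induction i)
  case (Suc i)
  have "Suc i * (Suc (m + i) choose Suc i) = Suc (m + i) * ((m + i) choose i)"
    by (metis Suc_times_binomial_eq mult.commute)
  also have "\<dots> \<le> (Suc i * (m + 1)) * (m + 1) ^ i"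
    by (intro mult_mono Suc.IH) (auto simp: algebra_simps)
  also have "\<dots> = Suc i * (m + 1) ^ Suc i"
    by (simp only: power_Suc mult.assoc)
  finally have "Suc i * ((m + Suc i) choose Suc i) \<le> Suc i * (m + 1) ^ Suc i"
    by (simp only: add_Suc_right)
  then show ?case
    using Suc_mult_le_cancel1 by blast
qed simp

text \<open>A transversal \<open>T\<close> above \<open>P\<close> has to take at least
  \<open>i\<close> points of \<open>G\<close> outside \<open>P\<close>, and any \<open>i\<close> of
  them can serve as \<open>Q\<close>.\<close>

lemma critical_over_branch:
  fixes t r :: nat
  assumes G: "G \<in> \<B>" "finite G" and P: "finite P"
  defines "i \<equiv> t - card (P \<inter> G)"
  shows "critical_over t \<B> P r \<subseteq> (\<Union>Q\<in>nsets (G - P) i. critical_over t \<B> (P \<union> Q) (r - i))"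
proof
  fix T assume T: "T \<in> critical_over t \<B> P r"
  then have fT: "finite T" and PT: "P \<subseteq> T" and cT: "card T = card P + r" and tG: "t \<le> card (T \<inter> G)"
    using G by (auto simp: critical_over_def critical_def)
  have "card (T \<inter> G) = card (P \<inter> G) + card (T \<inter> (G - P))"
  proof -
    have "T \<inter> G = (P \<inter> G) \<union> (T \<inter> (G - P))" using PT by auto
    then show ?thesis using G P by (simp add: card_Un_disjoint Int_Diff disjoint_iff)
  qed
  then have "i \<le> card (T \<inter> (G - P))" using tG by (simp add: i_def)
  then obtain Q where Q: "Q \<subseteq> T \<inter> (G - P)" "card Q = i" "finite Q"
    by (metis obtain_subset_with_card_n)
  have cPQ: "card (P \<union> Q) = card P + i" 
    using Q P by (subst card_Un_disjoint) auto
  have "card (P \<union> Q) \<le> card T" using fT PT Q by (intro card_mono) auto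
  then have "i \<le> r" using cPQ cT by simp
  then have "T \<in> critical_over t \<B> (P \<union> Q) (r - i)"
    using T Q PT cPQ by (auto simp: critical_over_def)
  moreover have "Q \<in> nsets (G - P) i" using Q by (auto simp: nsets_def)
  ultimately show "T \<in> (\<Union>Q\<in>nsets (G - P) i. critical_over t \<B> (P \<union> Q) (r - i))" by blast
qed

text \<open>Union bound over the branches. The binomial factor stays unsimplified: the first
  branching, from the empty set, keeps a binomial, while the later ones estimate it by a
  power.\<close>

lemma card_critical_over_branch:
  assumes G: "G \<in> \<B>" "finite G" and P: "finite P"
    and bound: "\<And>Q. Q \<in> nsets (G - P) (t - card (P \<inter> G)) \<Longrightarrow>
      finite (critical_over t \<B> (P \<union> Q) (r - (t - card (P \<inter> G)))) \<and>
      card (critical_over t \<B> (P \<union> Q) (r - (t - card (P \<inter> G)))) \<le> c"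
  shows "finite (critical_over t \<B> P r)"
    and "card (critical_over t \<B> P r) \<le> (card (G - P) choose (t - card (P \<inter> G))) * c"
proof -
  let ?i = "t - card (P \<inter> G)"
  let ?U = "\<lambda>Q. critical_over t \<B> (P \<union> Q) (r - ?i)"
  have fin: "finite (nsets (G - P) ?i)" using G by (simp add: finite_imp_finite_nsets)
  have fU: "finite (\<Union>Q\<in>nsets (G - P) ?i. ?U Q)" using fin bound by blast
  have sub: "critical_over t \<B> P r \<subseteq> (\<Union>Q\<in>nsets (G - P) ?i. ?U Q)"
    using critical_over_branch[OF G P] .
  show "finite (critical_over t \<B> P r)" using finite_subset[OF sub fU] .
  have "card (critical_over t \<B> P r) \<le> card (\<Union>Q\<in>nsets (G - P) ?i. ?U Q)"
    by (rule card_mono[OF fU sub])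
  also have "\<dots> \<le> (\<Sum>Q\<in>nsets (G - P) ?i. card (?U Q))" by (rule card_UN_le[OF fin])
  also have "\<dots> \<le> card (nsets (G - P) ?i) * c"
    using sum_bounded_above[of "nsets (G - P) ?i" "\<lambda>Q. card (?U Q)" c] bound by simp
  finally show "card (critical_over t \<B> P r) \<le> (card (G - P) choose ?i) * c"
    by (simp add: card_nsets)
qed

text \<open>Each added point costs a factor \<open>m + 1\<close>. By minimality, a proper subset
  \<open>P\<close> of a critical set falls short by some \<open>i > 0\<close> on a member
  \<open>G\<close>; then \<open>G - P\<close> has at most \<open>m + i\<close> points, so there are
  at most \<open>(m + 1) ^ i\<close> branches, each lacking only \<open>r - i\<close>
  points.\<close>

lemma card_critical_over:
  assumes "\<And>G. G \<in> \<B> \<Longrightarrow> finite G \<and> card G \<le> t + m" and "finite P"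
  shows "finite (critical_over t \<B> P r) \<and> card (critical_over t \<B> P r) \<le> (m + 1) ^ r"
  using \<open>finite P\<close>
proof (induction r arbitrary: P rule: less_induct)
  case (less r)
  show ?case
  proof (cases "r = 0 \<or> critical_over t \<B> P r = {}")
    case True
    have sub: "critical_over t \<B> P r \<subseteq> {P}"
    proof
      fix T assume T: "T \<in> critical_over t \<B> P r"
      then have "r = 0" using True by blast
      then have "finite T" "P \<subseteq> T" "card P = card T"
        using T by (simp_all add: critical_over_def critical_def)
      then show "T \<in> {P}" using card_subset_eq[of T P] by simp
    qed
    have "finite (critical_over t \<B> P r)" "card (critical_over t \<B> P r) \<le> 1"
      using finite_subset[OF sub] card_mono[OF _ sub] by simp_all
    moreover have "1 \<le> (m + 1) ^ r" by simp
    ultimately show ?thesis by linarith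
  next
    case False
    then obtain T where T: "T \<in> critical_over t \<B> P r" and r: "r > 0" by auto
    then have PT: "P \<subset> T" using r by (auto simp: critical_over_def)
    then obtain G where G: "G \<in> \<B>" and small: "card (P \<inter> G) < t"
      using T unfolding critical_over_def critical_def by blast
    have fG: "finite G" and cG: "card G \<le> t + m" using assms(1) G by auto
    define i where "i = t - card (P \<inter> G)"
    have i0: "0 < i" using small by (simp add: i_def)
    \<comment> \<open>The \<open>r\<close> points of \<open>T - P\<close> must supply the
      \<open>i\<close> points of \<open>G\<close> that \<open>P\<close> lacks. Hence
      \<open>r - i\<close> does not truncate and the exponents add up to \<open>r\<close>.\<close>
    have ir: "i \<le> r"
    proof -
      have "t \<le> card (T \<inter> G)" "finite T" using T G by (auto simp: critical_over_def critical_def)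
      moreover have "card (T \<inter> G) \<le> card ((P \<inter> G) \<union> (T - P))"
        using \<open>finite T\<close> fG by (intro card_mono) auto
      moreover have "card ((P \<inter> G) \<union> (T - P)) \<le> card (P \<inter> G) + card (T - P)"
        by (rule card_Un_le)
      moreover have "card (T - P) = r"
        using T PT less.prems by (simp add: critical_over_def card_Diff_subset)
      ultimately show ?thesis by (simp add: i_def)
    qed
    have "card (G - P) = card G - card (P \<inter> G)"
      using fG by (simp add: card_Diff_subset_Int Int_commute)
    then have GP: "card (G - P) \<le> m + i" using cG small by (simp add: i_def)
    have IH: "finite (critical_over t \<B> (P \<union> Q) (r - i)) \<and>
        card (critical_over t \<B> (P \<union> Q) (r - i)) \<le> (m + 1) ^ (r - i)"
      if "Q \<in> nsets (G - P) i" for Q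
      using that i0 r less.prems by (intro less.IH) (auto simp: nsets_def)
    note step = card_critical_over_branch[OF G fG less.prems, of t r, folded i_def, OF IH]
    have "card (critical_over t \<B> P r) \<le> (card (G - P) choose i) * (m + 1) ^ (r - i)"
      using step(2) by blast
    also have "\<dots> \<le> (m + 1) ^ i * (m + 1) ^ (r - i)"
      using binomial_right_mono[OF GP, of i] binomial_le_power[of m i] by (intro mult_mono) auto
    also have "\<dots> = (m + 1) ^ r" using ir by (simp flip: power_add)
    finally show ?thesis using step(1) by blast
  qed
qed

text \<open>Starting from the empty set, any member \<open>G\<close> is missed by the full
  \<open>t\<close>, so the first branching chooses a \<open>t\<close>-subset of \<open>G\<close>;
  the remaining \<open>m\<close> points cost \<open>m + 1\<close> each. This is far better than
  paying \<open>m + 1\<close> for all \<open>t + m\<close> points.\<close>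

lemma card_critical:
  assumes B: "\<And>G. G \<in> \<B> \<Longrightarrow> finite G \<and> card G \<le> t + m" and m: "0 < m"
  shows "finite {T. critical t \<B> T \<and> card T = t + m}"
    and "card {T. critical t \<B> T \<and> card T = t + m} \<le> ((t + m) choose t) * (m + 1) ^ m"
proof -
  have eq: "{T. critical t \<B> T \<and> card T = t + m} = critical_over t \<B> {} (t + m)"
    by (auto simp: critical_over_def)
  have "finite (critical_over t \<B> {} (t + m)) \<and>
    card (critical_over t \<B> {} (t + m)) \<le> ((t + m) choose t) * (m + 1) ^ m"
  proof (cases "critical_over t \<B> {} (t + m) = {}")
    case False
    then obtain T where T: "critical t \<B> T" "card T = t + m" by (auto simp: critical_over_def)
    then have "{} \<subset> T" using m by auto
    then obtain G where G: "G \<in> \<B>" using T(1) unfolding critical_def by blast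
    have fG: "finite G" and cG: "card G \<le> t + m" using B G by auto
    have "finite (critical_over t \<B> ({} \<union> Q) (t + m - t)) \<and>
        card (critical_over t \<B> ({} \<union> Q) (t + m - t)) \<le> (m + 1) ^ m"
      if "Q \<in> nsets (G - {}) t" for Q
      using card_critical_over[of \<B> t m Q m] B that by (simp add: nsets_def)
    then have "finite (critical_over t \<B> {} (t + m))"
      "card (critical_over t \<B> {} (t + m)) \<le> (card G choose t) * (m + 1) ^ m"
      using card_critical_over_branch[OF G fG finite.emptyI, of t "t + m" "(m + 1) ^ m"] by simp_all
    moreover have "(card G choose t) * (m + 1) ^ m \<le> ((t + m) choose t) * (m + 1) ^ m"
      using binomial_right_mono[OF cG] by (rule mult_le_mono1)
    ultimately show ?thesis by linarith
  qed simp
  then show "finite {T. critical t \<B> T \<and> card T = t + m}"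
    and "card {T. critical t \<B> T \<and> card T = t + m} \<le> ((t + m) choose t) * (m + 1) ^ m"
    unfolding eq by auto
qed

text \<open>
  After replacing the pair by its Galois closure among sets of size at most \<open>t + m\<close>, a set of
  the top layer either contains a smaller member of the closure or is critical.
\<close>

lemma peel_step:
  assumes V: "finite V" and m: "0 < m"
    and A: "\<And>X. X \<in> \<A> \<Longrightarrow> X \<subseteq> V \<and> card X \<le> t + m"
    and B: "\<And>X. X \<in> \<B> \<Longrightarrow> X \<subseteq> V \<and> card X \<le> t + m"
    and cross: "cross_intersecting t \<A> \<B>"
  obtains \<A>' \<B>' \<U> \<W> where
    "\<forall>X\<in>\<A>'. X \<subseteq> V \<and> card X < t + m"
    "\<forall>X\<in>\<B>'. X \<subseteq> V \<and> card X < t + m"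
    "cross_intersecting t \<A>' \<B>'"
    "\<U> \<subseteq> nsets V (t + m)" "card \<U> \<le> ((t + m) choose t) * (m + 1) ^ m"
    "\<W> \<subseteq> nsets V (t + m)" "card \<W> \<le> ((t + m) choose t) * (m + 1) ^ m"
    "\<forall>X\<in>\<A>. \<exists>Y\<in>\<A>' \<union> \<U>. Y \<subseteq> X"
    "\<forall>X\<in>\<B>. \<exists>Y\<in>\<B>' \<union> \<W>. Y \<subseteq> X"
proof -
  \<comment> \<open>\<open>dual \<C>\<close> consists of the \<open>t\<close>-transversals of
    \<open>\<C>\<close> of size at most \<open>t + m\<close>. By \<open>cover\<close> below, the
    smaller ones in \<open>low\<close> and the critical ones in \<open>top\<close> already generate
    all of it.\<close>
  define dual where "dual \<C> = {X. X \<subseteq> V \<and> card X \<le> t + m \<and> (\<forall>Y\<in>\<C>. t \<le> card (X \<inter> Y))}" for \<C>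
  define top where "top \<C> = {T. critical t \<C> T \<and> card T = t + m} \<inter> dual \<C>" for \<C>
  define low where "low \<C> = {X \<in> dual \<C>. card X < t + m}" for \<C>
  have top_nsets: "top \<C> \<subseteq> nsets V (t + m)" for \<C>
    using V by (auto simp: top_def dual_def nsets_def intro: finite_subset)
  have top_card: "card (top \<C>) \<le> ((t + m) choose t) * (m + 1) ^ m"
    if C: "\<And>X. X \<in> \<C> \<Longrightarrow> X \<subseteq> V \<and> card X \<le> t + m" for \<C>
  proof -
    have C': "finite G \<and> card G \<le> t + m" if "G \<in> \<C>" for G
      using C[OF that] V finite_subset by blast
    have "card (top \<C>) \<le> card {T. critical t \<C> T \<and> card T = t + m}"
      unfolding top_def by (intro card_mono card_critical(1)[OF C' m]) auto
    then show ?thesis using card_critical(2)[OF C' m, of \<C>] by linarith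
  qed
  have cover: "\<exists>Y\<in>low \<C> \<union> top \<C>. Y \<subseteq> X" if X: "X \<in> dual \<C>" for X \<C>
  proof (cases "card X < t + m \<or> X \<in> top \<C>")
    case True
    then show ?thesis using X by (auto simp: low_def)
  next
    case False
    have "finite X" using X V by (auto simp: dual_def intro: finite_subset)
    moreover have "\<not> critical t \<C> X"
      using False X by (auto simp: top_def dual_def)
    moreover have "\<forall>G\<in>\<C>. t \<le> card (X \<inter> G)" using X by (auto simp: dual_def)
    ultimately obtain Y where Y: "Y \<subset> X" "\<forall>G\<in>\<C>. t \<le> card (Y \<inter> G)"
      unfolding critical_def not_less[symmetric] by blast
    then have "card Y < card X" using \<open>finite X\<close> by (simp add: psubset_card_mono)
    then have "Y \<in> low \<C>" using Y X by (auto simp: low_def dual_def)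
    then show ?thesis using Y by blast
  qed
  \<comment> \<open>After this closure each family is the full dual of the other, so a transversal
    obtained by shrinking stays inside its family and still crosses the other one.\<close>
  define \<A>1 \<B>1 where "\<A>1 = dual \<B>" and "\<B>1 = dual \<A>1"
  have sub: "X \<subseteq> V \<and> card X \<le> t + m" if "X \<in> dual \<C>" for X \<C>
    using that by (auto simp: dual_def)
  have AA1: "\<A> \<subseteq> \<A>1" using A cross by (auto simp: \<A>1_def dual_def cross_intersecting_def)
  have bidual: "\<C> \<subseteq> dual (dual \<C>)" if "\<forall>X\<in>\<C>. X \<subseteq> V \<and> card X \<le> t + m" for \<C>
    using that by (auto simp: dual_def Int_commute)
  have BB1: "\<B> \<subseteq> \<B>1" unfolding \<B>1_def \<A>1_def using B by (intro bidual) blast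
  \<comment> \<open>The third dual equals the first, as in every Galois connection.\<close>
  have A1: "\<A>1 = dual \<B>1"
  proof
    show "\<A>1 \<subseteq> dual \<B>1" unfolding \<B>1_def \<A>1_def using sub by (intro bidual) blast
    show "dual \<B>1 \<subseteq> \<A>1" unfolding \<A>1_def using BB1 by (auto simp: dual_def)
  qed
  have cross': "cross_intersecting t (low \<B>1) (low \<A>1)"
    using A1 by (auto simp: cross_intersecting_def low_def \<B>1_def dual_def)
  show ?thesis
  proof (rule that[of "low \<B>1" "low \<A>1" "top \<B>1" "top \<A>1"])
    show "\<forall>X\<in>low \<B>1. X \<subseteq> V \<and> card X < t + m" by (auto simp: low_def dual_def)
    show "\<forall>X\<in>low \<A>1. X \<subseteq> V \<and> card X < t + m" by (auto simp: low_def dual_def)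
    show "\<forall>X\<in>\<A>. \<exists>Y\<in>low \<B>1 \<union> top \<B>1. Y \<subseteq> X"
      using cover[of _ \<B>1] AA1 A1 by blast
    show "\<forall>X\<in>\<B>. \<exists>Y\<in>low \<A>1 \<union> top \<A>1. Y \<subseteq> X"
      using cover[of _ \<A>1] BB1 \<B>1_def by blast
    show "card (top \<B>1) \<le> ((t + m) choose t) * (m + 1) ^ m"
      by (rule top_card) (auto simp: \<B>1_def dest: sub)
    show "card (top \<A>1) \<le> ((t + m) choose t) * (m + 1) ^ m"
      by (rule top_card) (auto simp: \<A>1_def dest: sub)
  qed (fact cross' top_nsets)+
qed

section \<open>Counting sets with a prescribed trace, and the loss caused by peeling\<close>

text \<open>Removing \<open>Z\<close> is a bijection onto the \<open>(k - card X)\<close>-subsets of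
  \<open>V - Z\<close>, with inverse \<open>F \<mapsto> F \<union> X\<close>.\<close>

lemma card_nsets_Int_eq:
  assumes V: "finite V" and Z: "Z \<subseteq> V" and X: "X \<subseteq> Z" and k: "card X \<le> k"
  shows "card {F \<in> nsets V k. F \<inter> Z = X} = (card V - card Z) choose (k - card X)"
proof -
  have fin: "finite X" "finite Z" using V Z X by (auto intro: finite_subset)
  have "bij_betw (\<lambda>F. F - Z) {F \<in> nsets V k. F \<inter> Z = X} (nsets (V - Z) (k - card X))"
  proof (rule bij_betw_byWitness[where f' = "\<lambda>F. F \<union> X"])
    show "\<forall>F\<in>{F \<in> nsets V k. F \<inter> Z = X}. F - Z \<union> X = F" by auto
    show "\<forall>F\<in>nsets (V - Z) (k - card X). F \<union> X - Z = F" using X by (auto simp: nsets_def)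
    show "(\<lambda>F. F - Z) ` {F \<in> nsets V k. F \<inter> Z = X} \<subseteq> nsets (V - Z) (k - card X)"
      by (auto simp: nsets_def card_Diff_subset_Int)
    show "(\<lambda>F. F \<union> X) ` nsets (V - Z) (k - card X) \<subseteq> {F \<in> nsets V k. F \<inter> Z = X}"
    proof (rule image_subsetI)
      fix F assume "F \<in> nsets (V - Z) (k - card X)"
      then have F: "F \<subseteq> V - Z" "finite F" "card F = k - card X" by (auto simp: nsets_def)
      have "card (F \<union> X) = card F + card X" using F fin X by (intro card_Un_disjoint) auto
      then show "F \<union> X \<in> {F \<in> nsets V k. F \<inter> Z = X}"
        using F fin X Z k by (auto simp: nsets_def)
    qed
  qed
  then have "card {F \<in> nsets V k. F \<inter> Z = X} = card (nsets (V - Z) (k - card X))"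
    by (rule bij_betw_same_card)
  then show ?thesis using fin Z by (simp add: card_nsets card_Diff_subset)
qed

lemma card_nsets_superset:
  assumes "finite V" "Y \<subseteq> V" "card Y \<le> k"
  shows "card {F \<in> nsets V k. Y \<subseteq> F} = (card V - card Y) choose (k - card Y)"
proof -
  have "{F \<in> nsets V k. Y \<subseteq> F} = {F \<in> nsets V k. F \<inter> Y = Y}" by auto
  then show ?thesis using card_nsets_Int_eq[of V Y Y k] assms by simp
qed

text \<open>A member that loses its generator in passing from \<open>\<A>\<close> to
  \<open>\<A>'\<close> contains a set of \<open>\<U>\<close>, and every such \<open>l\<close>-set
  lies in \<open>(card V - l) choose (k - l)\<close> sets of size \<open>k\<close>.\<close>

lemma card_uncovered_le:
  assumes V: "finite V" and F: "\<F> \<subseteq> nsets V k" and U: "\<U> \<subseteq> nsets V l" and l: "l \<le> k"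
    and cover: "\<forall>X\<in>\<A>. \<exists>Y\<in>\<A>' \<union> \<U>. Y \<subseteq> X"
  shows "card {F \<in> \<F>. \<forall>X\<in>\<A>'. \<not> X \<subseteq> F} \<le>
    card {F \<in> \<F>. \<forall>X\<in>\<A>. \<not> X \<subseteq> F} + card \<U> * ((card V - l) choose (k - l))"
proof -
  have fin: "finite (nsets V k)" "finite \<U>" "finite \<F>"
    using V F U finite_imp_finite_nsets[of V] by (auto intro: finite_subset)
  let ?N = "\<lambda>Y. {F \<in> nsets V k. Y \<subseteq> F}"
  have "{F \<in> \<F>. \<forall>X\<in>\<A>'. \<not> X \<subseteq> F} \<subseteq> {F \<in> \<F>. \<forall>X\<in>\<A>. \<not> X \<subseteq> F} \<union> (\<Union>Y\<in>\<U>. ?N Y)"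
  proof
    fix E assume E: "E \<in> {F \<in> \<F>. \<forall>X\<in>\<A>'. \<not> X \<subseteq> F}"
    show "E \<in> {F \<in> \<F>. \<forall>X\<in>\<A>. \<not> X \<subseteq> F} \<union> (\<Union>Y\<in>\<U>. ?N Y)"
    proof (cases "\<forall>X\<in>\<A>. \<not> X \<subseteq> E")
      case True
      then show ?thesis using E by simp
    next
      case False
      then obtain X where X: "X \<in> \<A>" "X \<subseteq> E" by blast
      then obtain Y where "Y \<in> \<A>' \<union> \<U>" "Y \<subseteq> X" using cover by meson
      then have "Y \<in> \<U>" "Y \<subseteq> E" using E X by blast+
      moreover have "E \<in> nsets V k" using E F by blast
      ultimately show ?thesis by blast
    qed
  qed
  then have "card {F \<in> \<F>. \<forall>X\<in>\<A>'. \<not> X \<subseteq> F} \<le> card ({F \<in> \<F>. \<forall>X\<in>\<A>. \<not> X \<subseteq> F} \<union> (\<Union>Y\<in>\<U>. ?N Y))"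
    using fin by (intro card_mono) auto
  also have "\<dots> \<le> card {F \<in> \<F>. \<forall>X\<in>\<A>. \<not> X \<subseteq> F} + card (\<Union>Y\<in>\<U>. ?N Y)"
    by (rule card_Un_le)
  also have "card (\<Union>Y\<in>\<U>. ?N Y) \<le> (\<Sum>Y\<in>\<U>. card (?N Y))" by (rule card_UN_le[OF fin(2)])
  also have "\<dots> = (\<Sum>Y\<in>\<U>. (card V - l) choose (k - l))"
  proof (rule sum.cong)
    fix Y assume "Y \<in> \<U>"
    then have "Y \<subseteq> V" "card Y = l" using U by (auto simp: nsets_def)
    then show "card (?N Y) = (card V - l) choose (k - l)"
      using card_nsets_superset[OF V, of Y k] l by simp
  qed simp
  also have "\<dots> = card \<U> * ((card V - l) choose (k - l))" by simp
  finally show ?thesis by simp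
qed

text \<open>The total loss over the layers \<open>m > j\<close>: the bound on the critical sets of
  size \<open>t + m\<close>, times the number of \<open>k\<close>-sets above each of them.\<close>

definition peel_bound :: "nat \<Rightarrow> nat \<Rightarrow> nat \<Rightarrow> nat \<Rightarrow> nat" where
  "peel_bound n k t j =
    (\<Sum>m\<in>{j<..k - t}. ((t + m) choose t) * (m + 1) ^ m * ((n - (t + m)) choose (k - (t + m))))"

text \<open>Downward induction on \<open>j\<close>. At \<open>j = k - t\<close> the families
  generate themselves and nothing is uncovered; each step down peels off the layer of size
  \<open>t + Suc i\<close> and adds its term to the loss.\<close>

lemma peel:
  assumes V: "finite V" and F: "\<F> \<subseteq> nsets V k" and G: "\<G> \<subseteq> nsets V k"
    and cross: "cross_intersecting t \<F> \<G>" and tk: "t \<le> k" and j: "j \<le> k - t"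
  shows "\<exists>\<A> \<B>. (\<forall>X\<in>\<A>. X \<subseteq> V \<and> card X \<le> t + j) \<and> (\<forall>X\<in>\<B>. X \<subseteq> V \<and> card X \<le> t + j) \<and>
    cross_intersecting t \<A> \<B> \<and>
    card {F \<in> \<F>. \<forall>X\<in>\<A>. \<not> X \<subseteq> F} \<le> peel_bound (card V) k t j \<and>
    card {F \<in> \<G>. \<forall>X\<in>\<B>. \<not> X \<subseteq> F} \<le> peel_bound (card V) k t j"
  using j
proof (induction rule: inc_induct)
  case base
  have "{F \<in> \<C>. \<forall>X\<in>\<C>. \<not> X \<subseteq> F} = {}" for \<C> :: "nat set set" by auto
  then have e: "card {F \<in> \<C>. \<forall>X\<in>\<C>. \<not> X \<subseteq> F} = 0" for \<C> :: "nat set set"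
    by (metis card.empty)
  have "\<forall>X\<in>\<F>. X \<subseteq> V \<and> card X \<le> t + (k - t)" "\<forall>X\<in>\<G>. X \<subseteq> V \<and> card X \<le> t + (k - t)"
    using F G by (auto simp: nsets_def)
  then show ?case using cross e by (intro exI[of _ \<F>] exI[of _ \<G>]) simp
next
  case (step i)
  then obtain \<A> \<B> where A: "\<forall>X\<in>\<A>. X \<subseteq> V \<and> card X \<le> t + Suc i"
    and B: "\<forall>X\<in>\<B>. X \<subseteq> V \<and> card X \<le> t + Suc i"
    and cross': "cross_intersecting t \<A> \<B>"
    and cF: "card {F \<in> \<F>. \<forall>X\<in>\<A>. \<not> X \<subseteq> F} \<le> peel_bound (card V) k t (Suc i)"
    and cG: "card {F \<in> \<G>. \<forall>X\<in>\<B>. \<not> X \<subseteq> F} \<le> peel_bound (card V) k t (Suc i)"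
    by blast
  have A': "\<And>X. X \<in> \<A> \<Longrightarrow> X \<subseteq> V \<and> card X \<le> t + Suc i"
    and B': "\<And>X. X \<in> \<B> \<Longrightarrow> X \<subseteq> V \<and> card X \<le> t + Suc i" using A B by blast+
  obtain \<A>' \<B>' \<U> \<W> where new:
    "\<forall>X\<in>\<A>'. X \<subseteq> V \<and> card X < t + Suc i"
    "\<forall>X\<in>\<B>'. X \<subseteq> V \<and> card X < t + Suc i"
    "cross_intersecting t \<A>' \<B>'"
    and U: "\<U> \<subseteq> nsets V (t + Suc i)" "card \<U> \<le> ((t + Suc i) choose t) * (Suc i + 1) ^ Suc i"
    and W: "\<W> \<subseteq> nsets V (t + Suc i)" "card \<W> \<le> ((t + Suc i) choose t) * (Suc i + 1) ^ Suc i"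
    and covA: "\<forall>X\<in>\<A>. \<exists>Y\<in>\<A>' \<union> \<U>. Y \<subseteq> X"
    and covB: "\<forall>X\<in>\<B>. \<exists>Y\<in>\<B>' \<union> \<W>. Y \<subseteq> X"
    by (rule peel_step[OF V zero_less_Suc A' B' cross'])
  let ?b = "(card V - (t + Suc i)) choose (k - (t + Suc i))"
  have "{i<..k - t} = insert (Suc i) {Suc i<..k - t}" using step(2) by auto
  then have bound: "peel_bound (card V) k t i =
      peel_bound (card V) k t (Suc i) + ((t + Suc i) choose t) * (Suc i + 1) ^ Suc i * ?b"
    unfolding peel_bound_def by (simp only: finite_greaterThanAtMost sum.insert) simp
  have l: "t + Suc i \<le> k" using step(2) tk by simp
  have "card {F \<in> \<F>. \<forall>X\<in>\<A>'. \<not> X \<subseteq> F} \<le>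
      card {F \<in> \<F>. \<forall>X\<in>\<A>. \<not> X \<subseteq> F} + card \<U> * ?b"
    by (rule card_uncovered_le[OF V F U(1) l covA])
  also have "\<dots> \<le> peel_bound (card V) k t i"
    unfolding bound by (intro add_mono cF mult_le_mono1 U)
  finally have F': "card {F \<in> \<F>. \<forall>X\<in>\<A>'. \<not> X \<subseteq> F} \<le> peel_bound (card V) k t i" .
  have "card {F \<in> \<G>. \<forall>X\<in>\<B>'. \<not> X \<subseteq> F} \<le>
      card {F \<in> \<G>. \<forall>X\<in>\<B>. \<not> X \<subseteq> F} + card \<W> * ?b"
    by (rule card_uncovered_le[OF V G W(1) l covB])
  also have "\<dots> \<le> peel_bound (card V) k t i"
    unfolding bound by (intro add_mono cG mult_le_mono1 W)
  finally have G': "card {F \<in> \<G>. \<forall>X\<in>\<B>'. \<not> X \<subseteq> F} \<le> peel_bound (card V) k t i" .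
  have "\<forall>X\<in>\<A>'. X \<subseteq> V \<and> card X \<le> t + i" "\<forall>X\<in>\<B>'. X \<subseteq> V \<and> card X \<le> t + i"
    using new(1,2) by fastforce+
  then show ?case using new(3) F' G' by blast
qed

subsection \<open>Cross intersecting families of sets of size at most \<open>t + 1\<close>\<close>

lemma cross_intersecting_sym: "cross_intersecting t \<F> \<G> \<Longrightarrow> cross_intersecting t \<G> \<F>"
  unfolding cross_intersecting_def by (metis Int_commute)

text \<open>If \<open>X\<close> left \<open>Z\<close>, then \<open>X \<inter> Z\<close> would have
  at most \<open>t\<close> points, so every member of \<open>\<B>\<close> would meet
  \<open>X\<close> in exactly this set; it would be a \<open>t\<close>-set common to all of
  \<open>\<B>\<close>.\<close>

lemma cross_intersecting_in_nsets:
  assumes A: "\<A> \<subseteq> nsets V (t + 1)" and B: "\<B> \<subseteq> nsets Z (t + 1)"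
    and cross: "cross_intersecting t \<A> \<B>"
    and star: "\<not> (\<exists>S\<in>nsets V t. \<forall>Y\<in>\<B>. S \<subseteq> Y)"
    and ne: "\<B> \<noteq> {}"
  shows "\<A> \<subseteq> nsets Z (t + 1)"
proof
  fix X assume X: "X \<in> \<A>"
  then have fX: "finite X" and cX: "card X = t + 1" and XV: "X \<subseteq> V" using A by (auto simp: nsets_def)
  have le: "t \<le> card (X \<inter> Y)" "Y \<subseteq> Z" if "Y \<in> \<B>" for Y
    using that cross X B by (auto simp: cross_intersecting_def nsets_def)
  have "X \<subseteq> Z"
  proof (rule ccontr)
    assume "\<not> X \<subseteq> Z"
    then have "X \<inter> Z \<subset> X" by auto
    then have small: "card (X \<inter> Z) < t + 1" using psubset_card_mono[OF fX] cX by metis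
    have eq: "X \<inter> Y = X \<inter> Z" if "Y \<in> \<B>" for Y
    proof -
      have "X \<inter> Y \<subseteq> X \<inter> Z" using le that by auto
      moreover have "card (X \<inter> Z) \<le> card (X \<inter> Y)" using le[OF that] small by simp
      ultimately show ?thesis using fX by (meson card_seteq finite_Int)
    qed
    have "X \<inter> Z \<subseteq> Y" if "Y \<in> \<B>" for Y using eq[OF that] by blast
    moreover have "X \<inter> Z \<in> nsets V t"
    proof -
      obtain Y where "Y \<in> \<B>" using ne by blast
      then have "t \<le> card (X \<inter> Z)" using le(1)[of Y] eq[of Y] by simp
      then show ?thesis using small fX XV by (auto simp: nsets_def)
    qed
    ultimately show False using star by blast
  qed
  then show "X \<in> nsets Z (t + 1)" using fX cX by (auto simp: nsets_def)
qed

text \<open>Two subsets of a \<open>(t + 1)\<close>-set with at least \<open>t\<close> points each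
  share at least \<open>t - 1\<close> points.\<close>

lemma card_Int_Int_ge:
  assumes "finite G" "card G = t + 1" "t \<le> card (G \<inter> P)" "t \<le> card (G \<inter> Q)"
  shows "t \<le> card (G \<inter> P \<inter> Q) + 1"
proof -
  have "card (G \<inter> P) + card (G \<inter> Q) = card ((G \<inter> P) \<union> (G \<inter> Q)) + card ((G \<inter> P) \<inter> (G \<inter> Q))"
    using assms(1) by (intro card_Un_Int) auto
  moreover have "card ((G \<inter> P) \<union> (G \<inter> Q)) \<le> card G"
    using assms(1) by (intro card_mono) auto
  moreover have "(G \<inter> P) \<inter> (G \<inter> Q) = G \<inter> P \<inter> Q" by auto
  ultimately show ?thesis using assms(2-4) by simp
qed

text \<open>A \<open>t\<close>-intersecting family without a common \<open>t\<close>-set contains a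
  triangle \<open>P\<close>, \<open>Q\<close>, \<open>R\<close> with fewer than \<open>t\<close>
  common points, and it lies in \<open>Z = P \<union> Q\<close>. A member \<open>G\<close> of
  \<open>\<B>\<close> leaving \<open>Z\<close> would have the same trace on all three, and this
  trace of at least \<open>t\<close> points would lie in
  \<open>P \<inter> Q \<inter> R\<close>.\<close>

lemma cross_intersecting_triangle:
  assumes A: "\<A> \<subseteq> nsets V (t + 1)" and B: "\<B> \<subseteq> nsets V (t + 1)"
    and cross: "cross_intersecting t \<A> \<B>"
    and starA: "\<not> (\<exists>S\<in>nsets V t. \<forall>X\<in>\<A>. S \<subseteq> X)"
    and ne: "\<A> \<noteq> {}"
    and int: "\<And>P Q. P \<in> \<A> \<Longrightarrow> Q \<in> \<A> \<Longrightarrow> t \<le> card (P \<inter> Q)"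
  shows "\<exists>Z\<in>nsets V (t + 2). \<B> \<subseteq> nsets Z (t + 1)"
proof -
  have A': "finite X \<and> card X = t + 1 \<and> X \<subseteq> V" if "X \<in> \<A>" for X using A that by (auto simp: nsets_def)
  have B': "finite X \<and> card X = t + 1 \<and> X \<subseteq> V" if "X \<in> \<B>" for X using B that by (auto simp: nsets_def)
  obtain P where P: "P \<in> \<A>" using ne by blast
  have eqt: "card (X \<inter> Y) = t" if "X \<in> \<A>" "Y \<in> \<A>" "X \<noteq> Y" for X Y
  proof -
    have "card (X \<inter> Y) \<noteq> t + 1"
      using that A'[of X] A'[of Y] by (metis card_seteq finite_Int inf_le1 inf_le2 order_refl)
    moreover have "card (X \<inter> Y) \<le> card X" using A'[OF that(1)] by (intro card_mono) auto
    ultimately show ?thesis using int[OF that(1,2)] A'[OF that(1)] by linarith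
  qed
  have "\<exists>Q\<in>\<A>. Q \<noteq> P"
  proof (rule ccontr)
    assume "\<not> ?thesis"
    then have eq: "\<And>X. X \<in> \<A> \<Longrightarrow> X = P" by blast
    obtain S where S: "S \<subseteq> P" "card S = t" "finite S"
      using obtain_subset_with_card_n[of t P] A'[OF P] by auto
    then have "S \<in> nsets V t" using A'[OF P] by (auto simp: nsets_def)
    then show False using starA S eq by blast
  qed
  then obtain Q where Q: "Q \<in> \<A>" "Q \<noteq> P" by blast
  have PQ: "card (P \<inter> Q) = t" using eqt[OF P Q(1)] Q(2) by blast
  moreover have "P \<inter> Q \<in> nsets V t" using PQ A'[OF P] by (auto simp: nsets_def)
  ultimately obtain R where R: "R \<in> \<A>" "\<not> P \<inter> Q \<subseteq> R" using starA by blast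
  have RP: "card (R \<inter> P) = t" and RQ: "card (R \<inter> Q) = t" using eqt P Q R by blast+
  define Z where "Z = P \<union> Q"
  have cZ: "card Z = t + 2"
    using card_Un_Int[of P Q] A'[OF P] A'[OF Q(1)] PQ by (simp add: Z_def)
  have fin: "finite P" "finite Q" "finite R" using A' P Q R by blast+
  have small: "card (P \<inter> Q \<inter> R) < t"
    using R(2) PQ fin psubset_card_mono[of "P \<inter> Q" "P \<inter> Q \<inter> R"] by auto
  have "G \<subseteq> Z" if G: "G \<in> \<B>" for G
  proof (rule ccontr)
    assume nG: "\<not> G \<subseteq> Z"
    have fG: "finite G" "card G = t + 1" using B'[OF G] by auto
    have le: "t \<le> card (G \<inter> X)" if "X \<in> \<A>" for X
      using cross G that by (auto simp: cross_intersecting_def Int_commute)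
    have "G \<inter> Z \<subset> G" using nG by blast
    then have s: "card (G \<inter> Z) \<le> t" using fG psubset_card_mono[of G "G \<inter> Z"] by simp
    have eqZ: "G \<inter> X = G \<inter> Z" if "X \<in> \<A>" "X \<subseteq> Z" for X
      using le[OF that(1)] s fG that(2) by (intro card_seteq) auto
    \<comment> \<open>\<open>R\<close> has \<open>t\<close> points in each of \<open>P\<close> and
      \<open>Q\<close> but fewer than \<open>t\<close> in both, so at least \<open>t + 1\<close>
      points in the union, which is all of \<open>R\<close>.\<close>
    have "R \<subseteq> Z"
    proof (rule ccontr)
      assume "\<not> R \<subseteq> Z"
      have "card ((R \<inter> P) \<union> (R \<inter> Q)) + card ((R \<inter> P) \<inter> (R \<inter> Q)) = 2 * t"
        using card_Un_Int[of "R \<inter> P" "R \<inter> Q"] fin RP RQ by simp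
      moreover have "(R \<inter> P) \<inter> (R \<inter> Q) = P \<inter> Q \<inter> R" "(R \<inter> P) \<union> (R \<inter> Q) = R \<inter> Z"
        by (auto simp: Z_def)
      moreover have "card (R \<inter> Z) < card R"
        using fin \<open>\<not> R \<subseteq> Z\<close> by (intro psubset_card_mono) auto
      ultimately show False using small A'[OF R(1)] by simp
    qed
    have "G \<inter> P = G \<inter> Z" "G \<inter> Q = G \<inter> Z" "G \<inter> R = G \<inter> Z"
      using eqZ P Q(1) R(1) \<open>R \<subseteq> Z\<close> by (auto simp: Z_def)
    then have "G \<inter> P \<subseteq> P \<inter> Q \<inter> R" by blast
    then have "card (G \<inter> P) \<le> card (P \<inter> Q \<inter> R)" using fin by (intro card_mono) auto
    then show False using le[OF P] small by linarith
  qed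
  then have "\<B> \<subseteq> nsets Z (t + 1)" using B' by (auto simp: nsets_def)
  moreover have "Z \<in> nsets V (t + 2)" using cZ fin A'[OF P] A'[OF Q(1)] by (auto simp: nsets_def Z_def)
  ultimately show ?thesis by blast
qed

lemma insert_insert_of_card:
  assumes "finite P" "card (P - I) = 2" "I \<subseteq> P"
  obtains a b where "a \<noteq> b" "a \<notin> I" "b \<notin> I" "P = insert a (insert b I)"
proof -
  obtain a b where "P - I = {a, b}" "a \<noteq> b" using assms(2) by (auto simp: card_2_iff)
  then show ?thesis using assms(3) that[of a b] by blast
qed

text \<open>
  The exceptional configuration: with \<open>I = P \<inter> Q\<close> removed, the members of both families
  are edges of a graph on the four points of \<open>(P \<union> Q) - I\<close>.
\<close>

lemma cross_intersecting_square:
  assumes A: "\<A> \<subseteq> nsets V (t + 1)" and B: "\<B> \<subseteq> nsets V (t + 1)"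
    and cross: "cross_intersecting t \<A> \<B>"
    and starB: "\<not> (\<exists>S\<in>nsets V t. \<forall>X\<in>\<B>. S \<subseteq> X)"
    and ne: "\<B> \<noteq> {}"
    and P: "P \<in> \<A>" and Q: "Q \<in> \<A>" and PQ: "card (P \<inter> Q) < t"
  shows "\<exists>S\<in>nsets V t. (\<exists>Y. \<forall>X\<in>\<A>. \<not> S \<subseteq> X \<longrightarrow> X = Y) \<or> (\<exists>Y. \<forall>X\<in>\<B>. \<not> S \<subseteq> X \<longrightarrow> X = Y)"
proof -
  have A': "finite X \<and> card X = t + 1 \<and> X \<subseteq> V" if "X \<in> \<A>" for X using A that by (auto simp: nsets_def)
  have B': "finite X \<and> card X = t + 1 \<and> X \<subseteq> V" if "X \<in> \<B>" for X using B that by (auto simp: nsets_def)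
  have le: "t \<le> card (G \<inter> X)" if "G \<in> \<B>" "X \<in> \<A>" for G X
    using cross that by (auto simp: cross_intersecting_def Int_commute)
  define I where "I = P \<inter> Q"
  have fin: "finite P" "finite Q" "finite I" using A' P Q by (auto simp: I_def)
  obtain G where G: "G \<in> \<B>" using ne by blast
  \<comment> \<open>Every \<open>G\<close> has at least \<open>t - 1\<close> points in
    \<open>P \<inter> Q\<close>, while \<open>I\<close> has at most \<open>t - 1\<close>; so
    \<open>I\<close> has exactly that many and lies in \<open>G\<close>.\<close>
  have IG: "I \<subseteq> G" and cI: "card I + 1 = t" if G: "G \<in> \<B>" for G
  proof -
    have "t \<le> card (G \<inter> P \<inter> Q) + 1" using card_Int_Int_ge[of G t P Q] B'[OF G] le[OF G] P Q by blast
    moreover have "card (G \<inter> P \<inter> Q) \<le> card I" unfolding I_def using fin by (intro card_mono) auto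
    ultimately have *: "card (G \<inter> P \<inter> Q) = card I" and "card I + 1 = t" using PQ by (auto simp: I_def)
    then show "card I + 1 = t" by simp
    have "G \<inter> P \<inter> Q = I" using * fin by (intro card_subset_eq) (auto simp: I_def)
    then show "I \<subseteq> G" by blast
  qed
  have t: "card I + 1 = t" using cI[OF G] .
  have "I \<subseteq> P" "I \<subseteq> Q" by (auto simp: I_def)
  have "card (P - I) = 2" "card (Q - I) = 2"
    using A'[OF P] A'[OF Q] fin t by (auto simp: card_Diff_subset I_def)
  obtain p1 p2 where p: "p1 \<noteq> p2" "p1 \<notin> I" "p2 \<notin> I" "P = insert p1 (insert p2 I)"
    by (rule insert_insert_of_card[OF fin(1) \<open>card (P - I) = 2\<close> \<open>I \<subseteq> P\<close>])
  obtain q1 q2 where q: "q1 \<noteq> q2" "q1 \<notin> I" "q2 \<notin> I" "Q = insert q1 (insert q2 I)"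
    by (rule insert_insert_of_card[OF fin(2) \<open>card (Q - I) = 2\<close> \<open>I \<subseteq> Q\<close>])
  have "p1 \<in> P" "p2 \<in> P" "q1 \<in> Q" "q2 \<in> Q" using p(4) q(4) by auto
  then have pq: "p1 \<noteq> q1" "p1 \<noteq> q2" "p2 \<noteq> q1" "p2 \<noteq> q2"
    using p(2,3) q(2,3) by (auto simp: I_def)
  \<comment> \<open>To reach \<open>t\<close> common points with \<open>P\<close> and with
    \<open>Q\<close>, the two points of \<open>G\<close> outside \<open>I\<close> must hit both
    pairs. So \<open>\<B>\<close> becomes a set of edges of the 4-cycle between
    \<open>{p1, p2}\<close> and \<open>{q1, q2}\<close>.\<close>
  have edge: "\<exists>a\<in>{p1, p2}. \<exists>b\<in>{q1, q2}. G = insert a (insert b I)" if G: "G \<in> \<B>" for G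
  proof -
    have fG: "finite G" "card G = t + 1" using B'[OF G] by auto
    have "card (G - I) = 2" using fG fin IG[OF G] t by (simp add: card_Diff_subset)
    then obtain a b where ab: "a \<noteq> b" "a \<notin> I" "b \<notin> I" "G = insert a (insert b I)"
      using insert_insert_of_card[of G I] IG[OF G] fG by blast
    note \<open>I \<subseteq> P\<close> \<open>I \<subseteq> Q\<close>
    moreover have "G \<inter> P \<noteq> I" "G \<inter> Q \<noteq> I" using le[OF G P] le[OF G Q] t by auto
    ultimately have "a \<in> P \<or> b \<in> P" "a \<in> Q \<or> b \<in> Q" using ab(4) by auto
    then have "a \<in> {p1,p2} \<or> b \<in> {p1,p2}" "a \<in> {q1,q2} \<or> b \<in> {q1,q2}"
      using ab(2,3) p(4) q(4) by auto
    then have "a \<in> {p1,p2} \<and> b \<in> {q1,q2} \<or> b \<in> {p1,p2} \<and> a \<in> {q1,q2}" using pq by auto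
    then show ?thesis using ab(4) by (auto simp: insert_commute)
  qed
  have inV: "insert a I \<in> nsets V t" if "a \<in> P \<union> Q" "a \<notin> I" for a
    using that A'[OF P] A'[OF Q] fin t by (auto simp: nsets_def I_def)
  have nstar: "\<exists>X\<in>\<B>. a \<notin> X" if "a \<in> P \<union> Q" "a \<notin> I" for a
  proof (rule ccontr)
    assume "\<not> ?thesis"
    then have "\<forall>X\<in>\<B>. insert a I \<subseteq> X" using IG by simp
    then show False using starB inV[OF that] by blast
  qed
  have disj: False if "insert a (insert b I) \<in> \<B>" "insert c (insert d I) \<in> \<A>"
    "{a, b} \<inter> {c, d} = {}" "a \<notin> I" "b \<notin> I" for a b c d
  proof -
    have "insert a (insert b I) \<inter> insert c (insert d I) \<subseteq> I"
      using that(3-5) by auto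
    then have "card (insert a (insert b I) \<inter> insert c (insert d I)) \<le> card I" using fin by (intro card_mono)
    then show False using le[OF that(1,2)] t by simp
  qed
  \<comment> \<open>Suppose \<open>\<B>\<close> contains two opposite edges. A member of
    \<open>\<A>\<close> other than \<open>P\<close> and \<open>Q\<close> must hit both, so it is one
    of the other two cycle edges; the edge opposite to it is then barred from \<open>\<B>\<close>,
    which leaves one exception to a star. The names \<open>q1\<close>, \<open>q2\<close> are rebound
    so that the argument also applies with them swapped.\<close>
  have opposite: ?thesis
    if q: "q1 \<noteq> q2" "q1 \<notin> I" "q2 \<notin> I" "Q = insert q1 (insert q2 I)"
      and pq: "p1 \<noteq> q1" "p1 \<noteq> q2" "p2 \<noteq> q1" "p2 \<noteq> q2"
      and edge: "\<And>G. G \<in> \<B> \<Longrightarrow> \<exists>a\<in>{p1, p2}. \<exists>b\<in>{q1, q2}. G = insert a (insert b I)"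
      and G1: "insert p1 (insert q1 I) \<in> \<B>" and G2: "insert p2 (insert q2 I) \<in> \<B>" for q1 q2
  proof (cases "\<A> \<subseteq> {P, Q}")
    case True
    have "\<forall>X\<in>\<A>. \<not> insert p1 I \<subseteq> X \<longrightarrow> X = Q" using True p(4) by auto
    then show ?thesis using inV[of p1] p(2) \<open>p1 \<in> P\<close> by blast
  next
    case False
    then obtain X where X: "X \<in> \<A>" "X \<noteq> P" "X \<noteq> Q" by blast
    let ?G1 = "insert p1 (insert q1 I)" and ?G2 = "insert p2 (insert q2 I)"
    have fX: "finite X" "card X = t + 1" using A'[OF X(1)] by auto
    have GG: "?G1 \<inter> ?G2 = I" using p(1-3) q(1-3) pq by auto
    have "t \<le> card (X \<inter> ?G1 \<inter> ?G2) + 1"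
      using card_Int_Int_ge[of X t ?G1 ?G2] fX le[OF G1 X(1)] le[OF G2 X(1)] by (simp add: Int_commute)
    moreover have "X \<inter> ?G1 \<inter> ?G2 = X \<inter> I" using GG by blast
    ultimately have "card I \<le> card (X \<inter> I)" using t by simp
    then have "X \<inter> I = I" using fin by (intro card_seteq) auto
    then have IX: "I \<subseteq> X" by blast
    then have "card (X - I) = 2" using fX fin t by (simp add: card_Diff_subset)
    then obtain a b where ab: "a \<noteq> b" "a \<notin> I" "b \<notin> I" "X = insert a (insert b I)"
      using insert_insert_of_card[of X I] IX fX by blast
    have "{p1, q1} \<inter> {a, b} \<noteq> {}" using disj[OF G1, of a b] X(1) ab(4) p(2) q(2) by auto
    moreover have "{p2, q2} \<inter> {a, b} \<noteq> {}" using disj[OF G2, of a b] X(1) ab(4) p(3) q(3) by auto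
    ultimately have "{a, b} \<in> {{p1, p2}, {p1, q2}, {q1, p2}, {q1, q2}}"
      using p(1) q(1) pq ab(1) by auto
    moreover have "{a, b} \<noteq> {p1, p2}" "{a, b} \<noteq> {q1, q2}"
      using X(2,3) ab(4) p(4) q(4) by (auto simp: doubleton_eq_iff insert_commute)
    ultimately have "X = insert p1 (insert q2 I) \<or> X = insert p2 (insert q1 I)"
      using ab(4) by (auto simp: doubleton_eq_iff insert_commute)
    then show ?thesis
    proof
      assume Xe: "X = insert p1 (insert q2 I)"
      have "Y = ?G2" if Y: "Y \<in> \<B>" "\<not> insert p1 I \<subseteq> Y" for Y
      proof -
        obtain b where "b \<in> {q1, q2}" "Y = insert p2 (insert b I)" using edge[OF Y(1)] Y(2) by blast
        moreover have "Y \<noteq> insert p2 (insert q1 I)"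
          using disj[of p2 q1 p1 q2] Y(1) X(1) Xe p(1-3) q(1-3) pq by auto
        ultimately show ?thesis by blast
      qed
      then show ?thesis using inV[of p1] p(2) \<open>p1 \<in> P\<close> by blast
    next
      assume Xe: "X = insert p2 (insert q1 I)"
      have "Y = ?G1" if Y: "Y \<in> \<B>" "\<not> insert p2 I \<subseteq> Y" for Y
      proof -
        obtain b where "b \<in> {q1, q2}" "Y = insert p1 (insert b I)" using edge[OF Y(1)] Y(2) by blast
        moreover have "Y \<noteq> insert p1 (insert q2 I)"
          using disj[of p1 q2 p2 q1] Y(1) X(1) Xe p(1-3) q(1-3) pq by auto
        ultimately show ?thesis by blast
      qed
      then show ?thesis using inV[of p2] p(3) \<open>p2 \<in> P\<close> by blast
    qed
  qed
  \<comment> \<open>No point of the cycle lies in all members of \<open>\<B>\<close>, and an edge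
    missing one point contains the other point of its pair. Thus all four points are covered, which
    forces two opposite edges.\<close>
  have miss: "\<exists>b\<in>{q1, q2}. insert p2 (insert b I) \<in> \<B>" "\<exists>b\<in>{q1, q2}. insert p1 (insert b I) \<in> \<B>"
    "\<exists>a\<in>{p1, p2}. insert a (insert q2 I) \<in> \<B>" "\<exists>a\<in>{p1, p2}. insert a (insert q1 I) \<in> \<B>"
  proof -
    obtain X1 where X1: "X1 \<in> \<B>" "p1 \<notin> X1" using nstar[of p1] p(2,3) \<open>p1 \<in> P\<close> by blast
    obtain X2 where X2: "X2 \<in> \<B>" "p2 \<notin> X2" using nstar[of p2] p(2,3) \<open>p2 \<in> P\<close> by blast
    obtain Y1 where Y1: "Y1 \<in> \<B>" "q1 \<notin> Y1" using nstar[of q1] q(2,3) \<open>q1 \<in> Q\<close> by blast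
    obtain Y2 where Y2: "Y2 \<in> \<B>" "q2 \<notin> Y2" using nstar[of q2] q(2,3) \<open>q2 \<in> Q\<close> by blast
    show "\<exists>b\<in>{q1, q2}. insert p2 (insert b I) \<in> \<B>" using edge[OF X1(1)] X1 by blast
    show "\<exists>b\<in>{q1, q2}. insert p1 (insert b I) \<in> \<B>" using edge[OF X2(1)] X2 by blast
    show "\<exists>a\<in>{p1, p2}. insert a (insert q2 I) \<in> \<B>" using edge[OF Y1(1)] Y1 by blast
    show "\<exists>a\<in>{p1, p2}. insert a (insert q1 I) \<in> \<B>" using edge[OF Y2(1)] Y2 by blast
  qed
  then have "insert p1 (insert q1 I) \<in> \<B> \<and> insert p2 (insert q2 I) \<in> \<B> \<or>
      insert p1 (insert q2 I) \<in> \<B> \<and> insert p2 (insert q1 I) \<in> \<B>" by blast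
  then show ?thesis
  proof (elim disjE conjE)
    assume "insert p1 (insert q1 I) \<in> \<B>" "insert p2 (insert q2 I) \<in> \<B>"
    then show ?thesis using opposite[of q1 q2] q pq edge by blast
  next
    assume *: "insert p1 (insert q2 I) \<in> \<B>" "insert p2 (insert q1 I) \<in> \<B>"
    show ?thesis
    proof (rule opposite[of q2 q1])
      show "Q = insert q2 (insert q1 I)" using q by blast
      show "\<exists>a\<in>{p1, p2}. \<exists>b\<in>{q2, q1}. G = insert a (insert b I)" if "G \<in> \<B>" for G
        using edge[OF that] by blast
    qed (use q pq * in auto)
  qed
qed

text \<open>Apart from stars, two members of \<open>\<A>\<close> with fewer than \<open>t\<close>
  common points lead to the 4-cycle. Otherwise the triangle argument puts \<open>\<B>\<close> into
  some \<open>Z\<close>, and \<open>\<A>\<close> follows because \<open>\<B>\<close> is not a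
  star.\<close>

lemma cross_intersecting_Suc_uniform:
  assumes A: "\<A> \<subseteq> nsets V (t + 1)" and B: "\<B> \<subseteq> nsets V (t + 1)"
    and cross: "cross_intersecting t \<A> \<B>"
    and ne: "\<A> \<noteq> {}" "\<B> \<noteq> {}"
  shows "(\<exists>Z\<in>nsets V (t + 2). \<A> \<subseteq> nsets Z (t + 1) \<and> \<B> \<subseteq> nsets Z (t + 1)) \<or>
    (\<exists>S\<in>nsets V t. (\<exists>Y. \<forall>X\<in>\<A>. \<not> S \<subseteq> X \<longrightarrow> X = Y) \<or> (\<exists>Y. \<forall>X\<in>\<B>. \<not> S \<subseteq> X \<longrightarrow> X = Y))"
proof (cases "(\<exists>S\<in>nsets V t. \<forall>X\<in>\<A>. S \<subseteq> X) \<or> (\<exists>S\<in>nsets V t. \<forall>X\<in>\<B>. S \<subseteq> X)")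
  case True
  then obtain S where "S \<in> nsets V t" "(\<forall>X\<in>\<A>. S \<subseteq> X) \<or> (\<forall>X\<in>\<B>. S \<subseteq> X)" by metis
  then show ?thesis by metis
next
  case False
  then have star: "\<not> (\<exists>S\<in>nsets V t. \<forall>X\<in>\<A>. S \<subseteq> X)" "\<not> (\<exists>S\<in>nsets V t. \<forall>X\<in>\<B>. S \<subseteq> X)"
    by simp_all
  show ?thesis
  proof (cases "\<exists>P\<in>\<A>. \<exists>Q\<in>\<A>. card (P \<inter> Q) < t")
    case True
    then obtain P Q where "P \<in> \<A>" "Q \<in> \<A>" "card (P \<inter> Q) < t" by metis
    then show ?thesis by (intro disjI2 cross_intersecting_square[OF A B cross star(2) ne(2)])
  next
    case False
    then have int: "t \<le> card (P \<inter> Q)" if "P \<in> \<A>" "Q \<in> \<A>" for P Q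
      using that by (meson not_less)
    obtain Z where Z: "Z \<in> nsets V (t + 2)" "\<B> \<subseteq> nsets Z (t + 1)"
      using cross_intersecting_triangle[OF A B cross star(1) ne(1) int] by metis
    then have "\<A> \<subseteq> nsets Z (t + 1)"
      using cross_intersecting_in_nsets[OF A Z(2) cross star(2) ne(2)] by simp
    then show ?thesis using Z by metis
  qed
qed

lemma cross_intersecting_Suc_cases:
  assumes A: "\<forall>X\<in>\<A>. X \<subseteq> V \<and> card X \<le> t + 1" and B: "\<forall>X\<in>\<B>. X \<subseteq> V \<and> card X \<le> t + 1"
    and cross: "cross_intersecting t \<A> \<B>" and V: "finite V" "t + 1 \<le> card V"
  obtains
    (left) S Y where "S \<in> nsets V t" "Y \<in> nsets V (t + 1)" "\<forall>X\<in>\<A>. \<not> S \<subseteq> X \<longrightarrow> X = Y"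
  | (right) S Y where "S \<in> nsets V t" "Y \<in> nsets V (t + 1)" "\<forall>X\<in>\<B>. \<not> S \<subseteq> X \<longrightarrow> X = Y"
  | (both) Z where "Z \<in> nsets V (t + 2)" "\<A> \<subseteq> nsets Z (t + 1)" "\<B> \<subseteq> nsets Z (t + 1)"
proof -
  \<comment> \<open>\<open>Y0\<close> and \<open>S0\<close> are default values for cases where there
    is no exception or no constraint on the centre; \<open>Y\<close> has to be a genuine
    \<open>(t + 1)\<close>-set for the later count of its supersets.\<close>
  obtain Y0 where Y0': "Y0 \<subseteq> V" "card Y0 = t + 1" "finite Y0"
    using obtain_subset_with_card_n[OF V(2)] by metis
  then have Y0: "Y0 \<in> nsets V (t + 1)" by (simp add: nsets_def)
  obtain S0 where "S0 \<subseteq> Y0" "card S0 = t" "finite S0"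
    using obtain_subset_with_card_n[of t Y0] Y0' by auto
  then have S0: "S0 \<in> nsets V t" using Y0' by (auto simp: nsets_def)
  \<comment> \<open>A set of size at most \<open>t\<close> meeting all of \<open>\<C>\<close> in at
    least \<open>t\<close> points is contained in all of them, so it is itself the centre of a
    star.\<close>
  have small: "\<exists>S\<in>nsets V t. \<forall>X\<in>\<C>. S \<subseteq> X"
    if Y: "Y \<in> \<D>" "Y \<subseteq> V" "card Y \<le> t" and cr: "\<And>X. X \<in> \<C> \<Longrightarrow> t \<le> card (X \<inter> Y)"
    for \<C> \<D> :: "nat set set" and Y
  proof (cases "\<C> = {}")
    case True
    then show ?thesis using S0 by blast
  next
    case False
    have fY: "finite Y" using Y(2) V(1) finite_subset by blast
    have eq: "X \<inter> Y = Y" if "X \<in> \<C>" for X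
      using cr[OF that] Y(3) fY by (intro card_seteq) auto
    obtain X where "X \<in> \<C>" using False by blast
    then have "card Y = t" using cr[of X] eq[of X] Y(3) by simp
    then have "Y \<in> nsets V t" using Y(2) fY by (simp add: nsets_def)
    moreover have "Y \<subseteq> X" if "X \<in> \<C>" for X using eq[OF that] by blast
    ultimately show ?thesis by blast
  qed
  show ?thesis
  proof (cases "\<A> = {} \<or> \<B> = {}")
    case True
    then show ?thesis using left[OF S0 Y0] right[OF S0 Y0] by blast
  next
    case ne: False
    show ?thesis
    proof (cases "(\<exists>Y\<in>\<A>. card Y \<le> t) \<or> (\<exists>Y\<in>\<B>. card Y \<le> t)")
      case True
      then show ?thesis
      proof
        assume "\<exists>Y\<in>\<A>. card Y \<le> t"
        then obtain Y where Y: "Y \<in> \<A>" "card Y \<le> t" by blast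
        have "\<exists>S\<in>nsets V t. \<forall>X\<in>\<B>. S \<subseteq> X"
          using Y A cross by (intro small[of Y \<A>]) (auto simp: cross_intersecting_def Int_commute)
        then obtain S where "S \<in> nsets V t" "\<forall>X\<in>\<B>. S \<subseteq> X" by blast
        then show ?thesis using right[of S Y0] Y0 by simp
      next
        assume "\<exists>Y\<in>\<B>. card Y \<le> t"
        then obtain Y where Y: "Y \<in> \<B>" "card Y \<le> t" by blast
        have "\<exists>S\<in>nsets V t. \<forall>X\<in>\<A>. S \<subseteq> X"
          using Y B cross by (intro small[of Y \<B>]) (auto simp: cross_intersecting_def)
        then obtain S where "S \<in> nsets V t" "\<forall>X\<in>\<A>. S \<subseteq> X" by blast
        then show ?thesis using left[of S Y0] Y0 by simp
      qed
    next
      case False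
      have uniform: "\<C> \<subseteq> nsets V (t + 1)"
        if "\<forall>X\<in>\<C>. X \<subseteq> V \<and> card X \<le> t + 1" "\<not> (\<exists>Y\<in>\<C>. card Y \<le> t)" for \<C>
      proof
        fix X assume "X \<in> \<C>"
        then have "X \<subseteq> V" "card X = t + 1" using that by force+
        then show "X \<in> nsets V (t + 1)" using V(1) finite_subset by (auto simp: nsets_def)
      qed
      have A1: "\<A> \<subseteq> nsets V (t + 1)" and B1: "\<B> \<subseteq> nsets V (t + 1)"
        using uniform A B False by simp_all
      have witness: "\<exists>Y'\<in>nsets V (t + 1). \<forall>X\<in>\<C>. \<not> S \<subseteq> X \<longrightarrow> X = Y'"
        if "\<C> \<subseteq> nsets V (t + 1)" "\<forall>X\<in>\<C>. \<not> S \<subseteq> X \<longrightarrow> X = Y" for \<C> S Y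
      proof (cases "Y \<in> nsets V (t + 1)")
        case True
        then show ?thesis using that by blast
      next
        case False
        then show ?thesis using that Y0 by blast
      qed
      have "\<A> \<noteq> {}" "\<B> \<noteq> {}" using ne by simp_all
      from cross_intersecting_Suc_uniform[OF A1 B1 cross this]
      consider Z where "Z \<in> nsets V (t + 2)" "\<A> \<subseteq> nsets Z (t + 1)" "\<B> \<subseteq> nsets Z (t + 1)"
        | S Y where "S \<in> nsets V t" "\<forall>X\<in>\<A>. \<not> S \<subseteq> X \<longrightarrow> X = Y"
        | S Y where "S \<in> nsets V t" "\<forall>X\<in>\<B>. \<not> S \<subseteq> X \<longrightarrow> X = Y" by metis
      then show ?thesis
      proof cases
        case 1
        then show ?thesis by (rule both)
      next
        case 2
        then show ?thesis using witness[OF A1] left by metis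
      next
        case 3
        then show ?thesis using witness[OF B1] right by metis
      qed
    qed
  qed
qed

subsection \<open>Numerical estimates\<close>

text \<open>Each step down multiplies the binomial by \<open>(b - m) / (a - m)\<close>, which is at
  most \<open>b / a\<close> because \<open>b \<le> a\<close>.\<close>

lemma binomial_descend_le:
  assumes "m \<le> b" "b \<le> a" "0 < a"
  shows "real ((a - m) choose (b - m)) \<le> (real b / real a) ^ m * real (a choose b)"
  using assms(1)
proof (induction m)
  case (Suc m)
  have "Suc (b - Suc m) * (Suc (a - Suc m) choose Suc (b - Suc m)) =
      Suc (a - Suc m) * ((a - Suc m) choose (b - Suc m))"
    using Suc_times_binomial_eq[of "a - Suc m" "b - Suc m"] by (simp only: mult.commute)
  moreover have "Suc (b - Suc m) = b - m" "Suc (a - Suc m) = a - m" using Suc.prems assms by auto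
  ultimately have "(b - m) * ((a - m) choose (b - m)) = (a - m) * ((a - Suc m) choose (b - Suc m))"
    by simp
  then have eq: "real (b - m) * real ((a - m) choose (b - m)) =
      real (a - m) * real ((a - Suc m) choose (b - Suc m))"
    by (metis of_nat_mult)
  have am: "0 < real (a - m)" using Suc.prems assms by simp
  have "real ((a - Suc m) choose (b - Suc m)) = real (b - m) / real (a - m) * real ((a - m) choose (b - m))"
    using eq am by (simp add: field_simps)
  also have "\<dots> \<le> real b / real a * ((real b / real a) ^ m * real (a choose b))"
  proof (rule mult_mono)
    have "real m * real b \<le> real m * real a" using assms by (intro mult_left_mono) auto
    then have "(real b - real m) * real a \<le> real b * (real a - real m)" by (simp add: algebra_simps)
    then show "real (b - m) / real (a - m) \<le> real b / real a"
      using am assms Suc.prems by (simp add: divide_simps of_nat_diff)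
  qed (use Suc in auto)
  finally show ?case by (simp add: mult.assoc)
qed simp

lemma one_plus_inverse_power_le_exp: "((real m + 2) / (real m + 1)) ^ (m + 1) \<le> exp 1"
proof -
  have "(real m + 2) / (real m + 1) = 1 + 1 / real (m + 1)" by (simp add: field_simps)
  also have "\<dots> \<le> exp (1 / real (m + 1))" by (rule exp_ge_add_one_self)
  finally have "((real m + 2) / (real m + 1)) ^ (m + 1) \<le> exp (1 / real (m + 1)) ^ (m + 1)"
    by (intro power_mono) auto
  also have "\<dots> = exp 1" by (metis exp_divide_power_eq zero_less_Suc Suc_eq_plus1 neq0_conv)
  finally show ?thesis .
qed

text \<open>The first hypothesis on \<open>t\<close> and \<open>x\<close> controls the terms
  \<open>c 2\<close>, \<open>c 3\<close>, \<open>c 4\<close>; the one with \<open>exp 1\<close>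
  makes the series at least halve at every step, so everything from \<open>c 4\<close> on is at most
  \<open>2 * c 4\<close>.\<close>

lemma peel_series_bound:
  fixes x :: real and t M :: nat
  defines "c \<equiv> \<lambda>m. real ((t + m) choose t) * real (m + 1) ^ m * x ^ m"
  assumes t: "2 \<le> t" and M: "2 \<le> M" and x: "0 \<le> x" "18 * (real t + 2) * x \<le> 1"
    and ex: "2 * exp 1 * real (t + M) * x \<le> 1"
  shows "(\<Sum>m\<in>{1<..M}. c m) \<le> 31 / 100 * (real t + 1) * x"
proof -
  have c0: "0 \<le> c m" for m using x by (simp add: c_def)
  \<comment> \<open>The binomial contributes \<open>(t + m + 1) / (m + 1)\<close> and the power
    \<open>(m + 2) ^ (m + 1) / (m + 1) ^ m\<close>; together they form a factor bounded by
    \<open>exp 1\<close>, times \<open>t + m + 1\<close>.\<close>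
  have rec: "c (Suc m) = c m * ((real t + real m + 1) * ((real m + 2) / (real m + 1)) ^ (m + 1) * x)" for m
  proof -
    have "Suc (t + m) * ((t + m) choose m) = (Suc (t + m) choose Suc m) * Suc m"
      using Suc_times_binomial_eq[of "t + m" m] by simp
    moreover have "(t + m) choose m = (t + m) choose t" "(Suc (t + m) choose Suc m) = (t + Suc m) choose t"
      using binomial_symmetric[of m "t + m"] binomial_symmetric[of "Suc m" "t + Suc m"] by simp_all
    ultimately have "Suc (t + m) * ((t + m) choose t) = ((t + Suc m) choose t) * Suc m" by simp
    then have "real (Suc (t + m)) * real ((t + m) choose t) = real ((t + Suc m) choose t) * real (Suc m)"
      by (metis of_nat_mult)
    then have "real ((t + Suc m) choose t) = real ((t + m) choose t) * (real t + real m + 1) / (real m + 1)"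
      by (simp add: field_simps)
    then have "c (Suc m) = real ((t + m) choose t) * (real t + real m + 1) / (real m + 1) *
        (real m + 2) ^ (m + 1) * x ^ Suc m"
      by (simp add: c_def add.commute)
    also have "\<dots> = real ((t + m) choose t) * (real m + 1) ^ m * x ^ m *
        ((real t + real m + 1) * ((real m + 2) ^ (m + 1) / (real m + 1) ^ (m + 1)) * x)"
    proof -
      have "b * T / p * q * (x * y) = b * P * y * (T * (q / (p * P)) * x)" if "P \<noteq> 0"
        for b T p q y P :: real
        using that by simp
      then show ?thesis by (simp only: power_Suc Suc_eq_plus1[symmetric]) simp
    qed
    finally show ?thesis by (simp add: c_def power_divide add.commute)
  qed
  have tx2: "(real t + 2) * x \<le> 1 / 18" using x by (simp add: algebra_simps)
  have tx: "real t * x \<le> 1 / 18 - 2 * x" using x by (simp add: algebra_simps)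
  have x72: "x \<le> 1 / 72" using tx mult_right_mono[of 2 "real t" x] t x by simp
  have "c 2 = 9 / 2 * (real t + 1) * ((real t + 2) * x) * x"
  proof -
    have "(t + 2) choose t = (t + 2) choose 2" using binomial_symmetric[of 2 "t + 2"] by simp
    moreover have "real ((t + 2) choose 2) = real (t + 2) * real (t + 1) / 2"
      by (simp add: choose_two real_of_nat_div algebra_simps)
    ultimately have "real ((t + 2) choose t) = real (t + 2) * real (t + 1) / 2" by simp
    then show ?thesis unfolding c_def by (simp only:) (simp add: power2_eq_square algebra_simps)
  qed
  also have "\<dots> \<le> 9 / 2 * (real t + 1) * (1 / 18) * x"
    using x(1) tx2 by (intro mult_right_mono mult_left_mono) auto
  finally have c2: "c 2 \<le> 1 / 4 * (real t + 1) * x" by (simp add: algebra_simps)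
  have "c 3 = c 2 * (64 / 27 * ((real t + 3) * x))"
    using rec[of 2] by (simp add: numeral_eq_Suc algebra_simps)
  \<comment> \<open>\<open>(t + 3) * x\<close> is at most \<open>1/18 + 1/72 = 5/72\<close>; in the
    next term \<open>(t + 4) * x\<close> is at most \<open>1/18 + 2/72 = 1/12\<close>.\<close>
  also have "\<dots> \<le> c 2 * (64 / 27 * (5 / 72))"
    using c0 tx x72 by (intro mult_left_mono) (auto simp: algebra_simps)
  finally have c3: "c 3 \<le> c 2 * (40 / 243)" by simp
  have "c 4 = c 3 * (625 / 256 * ((real t + 4) * x))"
    using rec[of 3] by (simp add: numeral_eq_Suc algebra_simps)
  also have "\<dots> \<le> c 3 * (625 / 256 * (1 / 12))"
    using c0 tx x72 by (intro mult_left_mono) (auto simp: algebra_simps)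
  finally have c4: "c 4 \<le> c 3 * (625 / 3072)" by simp
  have half: "c (Suc m) \<le> c m / 2" if "m < M" for m
  proof -
    have "(real t + real m + 1) * ((real m + 2) / (real m + 1)) ^ (m + 1) * x \<le> real (t + M) * exp 1 * x"
      using that x one_plus_inverse_power_le_exp[of m] by (intro mult_right_mono mult_mono) auto
    also have "\<dots> \<le> 1 / 2" using ex by (simp add: algebra_simps)
    finally have "c m * ((real t + real m + 1) * ((real m + 2) / (real m + 1)) ^ (m + 1) * x) \<le> c m * (1 / 2)"
      using c0 by (rule mult_left_mono)
    then show ?thesis using rec[of m] by simp
  qed
  \<comment> \<open>Counting the last term twice gives an invariant: a step replaces
    \<open>c m\<close> by \<open>2 * c (Suc m)\<close>, which is no larger.\<close>
  have tail: "m \<le> M \<Longrightarrow> (\<Sum>i\<in>{3<..m}. c i) + c m \<le> 2 * c 4" if "4 \<le> m" for m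
    using that
  proof (induction m rule: dec_induct)
    case base
    have "{3<..4} = {4::nat}" by auto
    then show ?case by simp
  next
    case (step m)
    have "{3<..Suc m} = insert (Suc m) {3<..m}" using step by auto
    then show ?case using step half[of m] by simp
  qed
  have "(\<Sum>m\<in>{1<..M}. c m) \<le> c 2 + c 3 + 2 * c 4"
  proof -
    consider "M = 2" | "M = 3" | "4 \<le> M" using M by linarith
    then show ?thesis
    proof cases
      case 1
      have "{1<..2} = {2::nat}" by auto
      then show ?thesis using 1 c0[of 3] c0[of 4] by simp
    next
      case 2
      have "{1<..3} = {2, 3::nat}" by auto
      then show ?thesis using 2 c0[of 4] by simp
    next
      case 3
      have "{1<..M} = {2, 3} \<union> {3<..M}" using 3 by auto
      then have "(\<Sum>m\<in>{1<..M}. c m) = c 2 + c 3 + (\<Sum>i\<in>{3<..M}. c i)"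
        by (simp add: sum.union_disjoint)
      then show ?thesis using tail[OF 3] c0[of M] by simp
    qed
  qed
  also have "\<dots> \<le> c 2 * (1 + 40 / 243 * (1 + 2 * (625 / 3072)))"
    using c3 c4 by simp
  \<comment> \<open>The bracket is about 1.232, and \<open>1.24 / 4\<close> gives the constant
    0.31.\<close>
  also have "\<dots> \<le> c 2 * (124 / 100)"
    using c0[of 2] by (intro mult_left_mono) auto
  also have "\<dots> \<le> 31 / 100 * (real t + 1) * x" using c2 by (simp add: algebra_simps)
  finally show ?thesis .
qed

text \<open>\<open>t * y\<close> is the diversity of the Frankl family. The second claim beats it in
  the star cases, the third when some member lies outside the Frankl family on \<open>Z\<close>, and
  the fourth serves the lower bound for the Frankl family itself.\<close>

lemma peel_bound_estimates:
  fixes n k t :: nat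
  assumes t: "2 \<le> t" and k: "t + 2 \<le> k"
    and n: "real n \<ge> real t + (real k - real t) * max (18 * (real t + 2)) (2 * exp 1 * real k)"
  defines "y \<equiv> (n - (t + 2)) choose (k - (t + 1))" and "z \<equiv> (n - (t + 3)) choose (k - (t + 2))"
  shows "k \<le> n"
    and "peel_bound n k t 1 + ((n - (t + 1)) choose (k - (t + 1))) < t * y"
    and "peel_bound n k t 1 + t * k * z < t * y"
    and "(t + 2) * z \<le> 2 * y"
proof -
  define a b where "a = n - t" and "b = k - t"
  have b2: "2 \<le> b" and kb: "k = t + b" using k by (auto simp: b_def)
  have "real b * (18 * (real t + 2)) \<le> real b * max (18 * (real t + 2)) (2 * exp 1 * real k)"
    "real b * (2 * exp 1 * real k) \<le> real b * max (18 * (real t + 2)) (2 * exp 1 * real k)"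
    by (intro mult_left_mono; simp)+
  moreover have "real k - real t = real b" by (simp add: kb)
  ultimately have n1: "real b * (18 * (real t + 2)) \<le> real n - real t"
    and n2: "real b * (2 * exp 1 * real k) \<le> real n - real t" using n by simp_all
  have "real b * 1 \<le> real b * (18 * (real t + 2))" by (intro mult_left_mono) auto
  then have "real b \<le> real n - real t" using n1 by simp
  then have kn: "k \<le> n" using kb by linarith
  then show "k \<le> n" .
  have a: "real a = real n - real t" "b \<le> a" "0 < a" using kn kb b2 by (auto simp: a_def)
  \<comment> \<open>The unit of all estimates is \<open>u\<close>, the number of
    \<open>k\<close>-sets containing a given \<open>(t + 1)\<close>-set.\<close>
  define x N u where "x = real b / real a" and "N = real (a choose b)" and "u = x * N"
  have x0: "0 < x" and N0: "0 < N" using a b2 by (auto simp: x_def N_def)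
  then have u0: "0 < u" by (simp add: u_def)
  have x1: "18 * (real t + 2) * x \<le> 1" using n1 a by (simp add: x_def field_simps)
  have x2: "2 * exp 1 * real (t + b) * x \<le> 1" using n2 a by (simp add: x_def field_simps kb)
  have x72: "x \<le> 1 / 72"
  proof -
    have "72 * x \<le> 18 * (real t + 2) * x" using x0 t by (intro mult_right_mono) auto
    then show ?thesis using x1 by simp
  qed
  have kx: "real k * x \<le> 1 / 5"
  proof -
    have "5 / 2 \<le> exp (1::real)" using exp_lower_Taylor_quadratic[of 1] by simp
    then have "2 * (5 / 2) * (real k * x) \<le> 2 * exp 1 * (real k * x)"
      using x0 by (intro mult_right_mono) auto
    then show ?thesis using x2 by (simp add: kb mult.assoc)
  qed
  have R: "real (peel_bound n k t 1) \<le> 31 / 100 * (real t + 1) * u"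
  proof -
    have "real (peel_bound n k t 1) = (\<Sum>m\<in>{1<..b}. real ((t + m) choose t) * real (m + 1) ^ m *
        real ((n - (t + m)) choose (k - (t + m))))"
      by (simp add: peel_bound_def b_def)
    also have "\<dots> \<le> (\<Sum>m\<in>{1<..b}. real ((t + m) choose t) * real (m + 1) ^ m * x ^ m * N)"
    proof (rule sum_mono)
      fix m assume "m \<in> {1<..b}"
      then have "real ((n - (t + m)) choose (k - (t + m))) \<le> x ^ m * N"
        using binomial_descend_le[of m b a] a by (simp add: a_def b_def x_def N_def)
      then show "real ((t + m) choose t) * real (m + 1) ^ m * real ((n - (t + m)) choose (k - (t + m)))
          \<le> real ((t + m) choose t) * real (m + 1) ^ m * x ^ m * N"
        unfolding mult.assoc by (intro mult_left_mono) auto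
    qed
    also have "\<dots> = (\<Sum>m\<in>{1<..b}. real ((t + m) choose t) * real (m + 1) ^ m * x ^ m) * N"
      by (rule sum_distrib_right[symmetric])
    also have "\<dots> \<le> (31 / 100 * (real t + 1) * x) * N"
      using peel_series_bound[OF t b2 less_imp_le[OF x0] x1 x2] N0 by (intro mult_right_mono) auto
    finally show ?thesis by (simp add: u_def mult.assoc)
  qed
  have z1: "real ((n - (t + 1)) choose (k - (t + 1))) = u"
  proof -
    have "b * (a choose b) = a * ((a - 1) choose (b - 1))"
      using b2 by (intro times_binomial_minus1_eq) auto
    then have "real b * N = real a * real ((a - 1) choose (b - 1))"
      unfolding N_def by (metis of_nat_mult)
    then show ?thesis using a by (simp add: u_def x_def field_simps a_def b_def)
  qed
  have w: "real ((a - 2) choose (b - 2)) \<le> x * u"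
    using binomial_descend_le[of 2 b a] a b2 by (simp add: x_def u_def N_def power2_eq_square mult.assoc)
  have y: "u - x * u \<le> real y"
  proof -
    \<comment> \<open>Pascal's rule shows that \<open>y\<close> differs from \<open>u\<close> by a
      binomial of order \<open>x * u\<close>.\<close>
    have "(n - (t + 1)) choose (k - (t + 1)) = ((a - 2) choose (b - 2)) + y"
      using choose_reduce_nat[of "a - 1" "b - 1"] a b2
      by (simp add: a_def b_def y_def numeral_eq_Suc)
    then have "u = real ((a - 2) choose (b - 2)) + real y" unfolding z1[symmetric] by simp
    then show ?thesis using w by simp
  qed
  have z: "real z \<le> x * u"
  proof -
    have "z \<le> (a - 2) choose (b - 2)"
      unfolding z_def a_def b_def diff_diff_left by (rule binomial_right_mono) simp
    then show ?thesis using w by linarith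
  qed
  have "x * u \<le> 1 / 72 * u" using x72 u0 by (intro mult_right_mono) auto
  then have y': "71 / 72 * u \<le> real y" using y by simp
  then have ty: "71 / 72 * (real t * u) \<le> real t * real y"
    using mult_left_mono[OF y', of "real t"] by simp
  have tu: "2 * u \<le> real t * u" using t u0 by (intro mult_right_mono) auto
  have R': "real (peel_bound n k t 1) \<le> 31 / 100 * (real t * u) + 31 / 100 * u"
    using R by (simp add: algebra_simps)
  \<comment> \<open>In units of \<open>u\<close> this is
    \<open>0.31 * t + 1.31 < (71/72) * t\<close>. It is close at \<open>t = 2\<close>, where it
    reads \<open>1.93 < 1.972...\<close>.\<close>
  have "real (peel_bound n k t 1) + u < real t * real y"
    using R' ty tu u0 by linarith
  then have "real (peel_bound n k t 1 + ((n - (t + 1)) choose (k - (t + 1)))) < real (t * y)"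
    using z1 by simp
  then show "peel_bound n k t 1 + ((n - (t + 1)) choose (k - (t + 1))) < t * y"
    unfolding of_nat_less_iff .
  have "real k * real z \<le> real k * (x * u)" using z by (intro mult_left_mono) auto
  also have "\<dots> = (real k * x) * u" by simp
  also have "\<dots> \<le> 1 / 5 * u" using kx u0 by (intro mult_right_mono) auto
  finally have "real t * (real k * real z) \<le> real t * (1 / 5 * u)" by (intro mult_left_mono) auto
  then have "real (peel_bound n k t 1) + real t * (real k * real z) < real t * real y"
    using R' ty tu u0 by linarith
  then have "real (peel_bound n k t 1 + t * k * z) < real (t * y)" by (simp add: mult.assoc)
  then show "peel_bound n k t 1 + t * k * z < t * y" unfolding of_nat_less_iff .
  have "(real t + 2) * real z \<le> (real t + 2) * (x * u)" using z by (intro mult_left_mono) auto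
  also have "\<dots> = ((real t + 2) * x) * u" by simp
  also have "\<dots> \<le> 1 * u" using x1 x0 u0 by (intro mult_right_mono) (auto simp: algebra_simps)
  also have "\<dots> \<le> 2 * real y" using y' u0 by linarith
  finally have "real ((t + 2) * z) \<le> real (2 * y)" by (simp add: algebra_simps)
  then show "(t + 2) * z \<le> 2 * y" unfolding of_nat_le_iff .
qed

subsection \<open>Diversity\<close>

lemma card_missing:
  assumes "finite \<F>"
  shows "card \<F> - card {F \<in> \<F>. S \<subseteq> F} = card {F \<in> \<F>. \<not> S \<subseteq> F}"
proof -
  have "\<F> - {F \<in> \<F>. S \<subseteq> F} = {F \<in> \<F>. \<not> S \<subseteq> F}" by auto
  then show ?thesis using assms card_Diff_subset[of "{F \<in> \<F>. S \<subseteq> F}" \<F>] by auto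
qed

text \<open>Diversity is the minimum, over the \<open>t\<close>-sets \<open>S\<close>, of the number
  of members not containing \<open>S\<close>. This is the upper bound; the next lemma provides a
  minimiser.\<close>

lemma diversity_le:
  assumes "finite \<F>" "S \<in> nsets {1..n} t"
  shows "diversity n t \<F> \<le> card {F \<in> \<F>. \<not> S \<subseteq> F}"
proof -
  have "card {F \<in> \<F>. S \<subseteq> F} \<le> max_degree n t \<F>"
    unfolding max_degree_def using assms by (intro Max_ge) (auto simp: finite_imp_finite_nsets)
  then show ?thesis unfolding diversity_def card_missing[OF assms(1), symmetric] by simp
qed

lemma diversity_attained:
  assumes "finite \<F>" "t \<le> n"
  obtains S where "S \<in> nsets {1..n} t" "diversity n t \<F> = card {F \<in> \<F>. \<not> S \<subseteq> F}"
proof -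
  have "{1..t} \<in> nsets {1..n} t" using assms(2) by (auto simp: nsets_def)
  then have "max_degree n t \<F> \<in> (\<lambda>S. card {F \<in> \<F>. S \<subseteq> F}) ` nsets {1..n} t"
    unfolding max_degree_def by (intro Max_in) (auto simp: finite_imp_finite_nsets)
  then obtain S where "S \<in> nsets {1..n} t" "max_degree n t \<F> = card {F \<in> \<F>. S \<subseteq> F}" by blast
  then show ?thesis using that card_missing[OF assms(1), of S] by (simp add: diversity_def)
qed

lemma Int_eq_Diff_singleton:
  assumes "finite Z" "card Z = t + 2" "t + 1 \<le> card (F \<inter> Z)" "c \<in> Z" "c \<notin> F"
  shows "F \<inter> Z = Z - {c}"
  using assms by (intro card_seteq) auto

text \<open>Take any \<open>t\<close>-subset \<open>S\<close> of \<open>Z\<close>. A member missing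
  \<open>c \<in> S\<close> has trace exactly \<open>Z - {c}\<close>, which leaves \<open>t\<close>
  classes of equal size.\<close>

lemma diversity_frankl_on_subset_le:
  assumes F: "\<F> \<subseteq> frankl_on n k t Z" and Z: "Z \<in> nsets {1..n} (t + 2)" and k: "t + 1 \<le> k"
  shows "diversity n t \<F> \<le> t * ((n - (t + 2)) choose (k - (t + 1)))"
proof -
  have Z': "finite Z" "card Z = t + 2" "Z \<subseteq> {1..n}" using Z by (auto simp: nsets_def)
  obtain S where S: "S \<subseteq> Z" "card S = t" "finite S"
    using obtain_subset_with_card_n[of t Z] Z' by auto
  let ?K = "\<lambda>c. {F \<in> nsets {1..n} k. F \<inter> Z = Z - {c}}"
  have fin: "finite (nsets {1..n} k)" by (simp add: finite_imp_finite_nsets)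
  have fF: "finite \<F>" using F fin by (auto simp: frankl_on_def intro: finite_subset)
  have "diversity n t \<F> \<le> card {F \<in> \<F>. \<not> S \<subseteq> F}"
    using fF S Z' by (intro diversity_le) (auto simp: nsets_def)
  also have "\<dots> \<le> card (\<Union>c\<in>S. ?K c)"
  proof (rule card_mono)
    show "{F \<in> \<F>. \<not> S \<subseteq> F} \<subseteq> (\<Union>c\<in>S. ?K c)"
    proof
      fix E assume E: "E \<in> {F \<in> \<F>. \<not> S \<subseteq> F}"
      then obtain c where c: "c \<in> S" "c \<notin> E" by blast
      have "E \<in> nsets {1..n} k" "t + 1 \<le> card (E \<inter> Z)" using E F by (auto simp: frankl_on_def)
      then show "E \<in> (\<Union>c\<in>S. ?K c)" using Int_eq_Diff_singleton[OF Z'(1,2)] c S(1) by blast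
    qed
  qed (use S fin in auto)
  also have "\<dots> \<le> (\<Sum>c\<in>S. card (?K c))" by (rule card_UN_le[OF S(3)])
  also have "\<dots> = (\<Sum>c\<in>S. (n - (t + 2)) choose (k - (t + 1)))"
  proof (rule sum.cong)
    fix c assume "c \<in> S"
    then have "c \<in> Z" using S by blast
    then show "card (?K c) = (n - (t + 2)) choose (k - (t + 1))"
      using card_nsets_Int_eq[of "{1..n}" Z "Z - {c}" k] Z' k by simp
  qed simp
  finally show ?thesis using S by simp
qed

text \<open>If \<open>S \<subseteq> Z\<close>, the \<open>t\<close> disjoint classes with trace
  \<open>Z - {c}\<close>, \<open>c \<in> S\<close>, all miss \<open>S\<close>. Otherwise fix
  \<open>s \<in> S - Z\<close>: all \<open>t + 2\<close> classes contribute their members avoiding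
  \<open>s\<close>, and \<open>num\<close> says that the two additional classes outweigh the members
  containing \<open>s\<close>.\<close>

lemma card_frankl_on_missing_ge:
  assumes Z: "Z \<in> nsets {1..n} (t + 2)" and S: "S \<in> nsets {1..n} t" and k: "t + 2 \<le> k"
    and num: "(t + 2) * ((n - (t + 3)) choose (k - (t + 2))) \<le> 2 * ((n - (t + 2)) choose (k - (t + 1)))"
  shows "t * ((n - (t + 2)) choose (k - (t + 1))) \<le> card {F \<in> frankl_on n k t Z. \<not> S \<subseteq> F}"
proof -
  let ?y = "(n - (t + 2)) choose (k - (t + 1))" and ?z = "(n - (t + 3)) choose (k - (t + 2))"
  have Z': "finite Z" "card Z = t + 2" "Z \<subseteq> {1..n}" using Z by (auto simp: nsets_def)
  have S': "finite S" "card S = t" "S \<subseteq> {1..n}" using S by (auto simp: nsets_def)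
  let ?K = "\<lambda>c. {F \<in> nsets {1..n} k. F \<inter> Z = Z - {c}}"
  have fin: "finite (nsets {1..n} k)" by (simp add: finite_imp_finite_nsets)
  have cK: "card (?K c) = ?y" if "c \<in> Z" for c
    using card_nsets_Int_eq[of "{1..n}" Z "Z - {c}" k] Z' k that by simp
  have sub: "?K c \<subseteq> frankl_on n k t Z" if "c \<in> Z" for c
    using Z' that by (auto simp: frankl_on_def)
  have disj: "?K c \<inter> ?K d = {}" if "c \<in> Z" "d \<in> Z" "c \<noteq> d" for c d
    using that by blast
  show ?thesis
  proof (cases "S \<subseteq> Z")
    case True
    have "t * ?y = (\<Sum>c\<in>S. card (?K c))"
      using cK True S' by (simp add: subset_iff)
    also have "\<dots> = card (\<Union>c\<in>S. ?K c)"
      using S' fin disj True by (intro card_UN_disjoint[symmetric]) (auto simp: subset_iff)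
    also have "\<dots> \<le> card {F \<in> frankl_on n k t Z. \<not> S \<subseteq> F}"
    proof (rule card_mono)
      show "(\<Union>c\<in>S. ?K c) \<subseteq> {F \<in> frankl_on n k t Z. \<not> S \<subseteq> F}"
      proof (rule UN_least)
        fix c assume c: "c \<in> S"
        then have "?K c \<subseteq> frankl_on n k t Z" using True by (intro sub) blast
        moreover have "\<not> S \<subseteq> F" if "F \<in> ?K c" for F using that c True by blast
        ultimately show "?K c \<subseteq> {F \<in> frankl_on n k t Z. \<not> S \<subseteq> F}" by blast
      qed
    qed (use fin in \<open>auto simp: frankl_on_def\<close>)
    finally show ?thesis .
  next
    case False
    then obtain s where s: "s \<in> S" "s \<notin> Z" by blast
    let ?L = "\<lambda>c. {F \<in> nsets {1..n} k. F \<inter> insert s Z = insert s (Z - {c})}"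
    have cL: "card (?L c) = ?z" if "c \<in> Z" for c
    proof -
      have cards: "card (insert s (Z - {c})) = t + 2" "card (insert s Z) = t + 3"
        using Z' s that by simp_all
      have "insert s Z \<subseteq> {1..n}" "insert s (Z - {c}) \<subseteq> insert s Z" using Z' S' s by blast+
      from card_nsets_Int_eq[OF finite_atLeastAtMost this, of k]
      show ?thesis unfolding cards using k by simp
    qed
    have LK: "?L c \<subseteq> ?K c" for c
    proof -
      have trace: "F \<inter> insert s Z = insert s (Z - {c}) \<Longrightarrow> F \<inter> Z = Z - {c}" for F
      proof -
        assume eq: "F \<inter> insert s Z = insert s (Z - {c})"
        have "F \<inter> Z = (F \<inter> insert s Z) \<inter> Z" by blast
        also have "\<dots> = Z - {c}" unfolding eq using s(2) by blast
        finally show "F \<inter> Z = Z - {c}" .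
      qed
      show ?thesis by (intro Collect_mono impI conjI; elim conjE) (assumption, rule trace)
    qed
    have cD: "card (?K c - ?L c) = ?y - ?z" if "c \<in> Z" for c
    proof -
      have "finite (?L c)" using fin by simp
      then have "card (?K c - ?L c) = card (?K c) - card (?L c)" using LK by (rule card_Diff_subset)
      then show ?thesis by (simp only: cK[OF that] cL[OF that])
    qed
    have "t * ?y \<le> (t + 2) * (?y - ?z)"
      using num unfolding diff_mult_distrib2 add_mult_distrib by linarith
    also have "\<dots> = (\<Sum>c\<in>Z. ?y - ?z)" using Z' by simp
    also have "\<dots> = (\<Sum>c\<in>Z. card (?K c - ?L c))" by (intro sum.cong refl) (simp only: cD)
    also have "\<dots> = card (\<Union>c\<in>Z. ?K c - ?L c)"
    proof (rule card_UN_disjoint[symmetric])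
      show "\<forall>c\<in>Z. \<forall>d\<in>Z. c \<noteq> d \<longrightarrow> (?K c - ?L c) \<inter> (?K d - ?L d) = {}"
        using disj by blast
    qed (use Z' fin in auto)
    also have "\<dots> \<le> card {F \<in> frankl_on n k t Z. \<not> S \<subseteq> F}"
    proof (rule card_mono)
      show "(\<Union>c\<in>Z. ?K c - ?L c) \<subseteq> {F \<in> frankl_on n k t Z. \<not> S \<subseteq> F}"
      proof (rule UN_least)
        fix c assume c: "c \<in> Z"
        have "?K c \<subseteq> frankl_on n k t Z" using c by (rule sub)
        moreover have "s \<notin> F" if "F \<in> ?K c - ?L c" for F
        proof
          assume "s \<in> F"
          then have eq: "F \<inter> insert s Z = insert s (F \<inter> Z)" by blast
          show False using that unfolding Diff_iff mem_Collect_eq eq by metis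
        qed
        ultimately show "?K c - ?L c \<subseteq> {F \<in> frankl_on n k t Z. \<not> S \<subseteq> F}" using s(1) by blast
      qed
    qed (use fin in \<open>auto simp: frankl_on_def\<close>)
    finally show ?thesis .
  qed
qed

section \<open>Upper bounds on diversity after peeling\<close>

text \<open>A member not containing \<open>S\<close> is either uncovered or contains a generator
  that does not contain \<open>S\<close>, and that generator can only be \<open>Y\<close>.\<close>

lemma diversity_le_of_uncovered:
  assumes F: "\<F> \<subseteq> nsets {1..n} k" and k: "t + 1 \<le> k"
    and S: "S \<in> nsets {1..n} t" and Y: "Y \<in> nsets {1..n} (t + 1)"
    and A: "\<forall>X\<in>\<A>. \<not> S \<subseteq> X \<longrightarrow> X = Y"
    and unc: "card {F \<in> \<F>. \<forall>X\<in>\<A>. \<not> X \<subseteq> F} \<le> r"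
  shows "diversity n t \<F> \<le> r + ((n - (t + 1)) choose (k - (t + 1)))"
proof -
  have fin: "finite (nsets {1..n} k)" by (simp add: finite_imp_finite_nsets)
  then have fF: "finite \<F>" using F finite_subset by blast
  have "diversity n t \<F> \<le> card {F \<in> \<F>. \<not> S \<subseteq> F}" by (rule diversity_le[OF fF S])
  also have "\<dots> \<le> card ({F \<in> \<F>. \<forall>X\<in>\<A>. \<not> X \<subseteq> F} \<union> {F \<in> nsets {1..n} k. Y \<subseteq> F})"
  proof (rule card_mono)
    show "{F \<in> \<F>. \<not> S \<subseteq> F} \<subseteq> {F \<in> \<F>. \<forall>X\<in>\<A>. \<not> X \<subseteq> F} \<union> {F \<in> nsets {1..n} k. Y \<subseteq> F}"
      using A F by blast
  qed (use fF fin in auto)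
  also have "\<dots> \<le> card {F \<in> \<F>. \<forall>X\<in>\<A>. \<not> X \<subseteq> F} + card {F \<in> nsets {1..n} k. Y \<subseteq> F}"
    by (rule card_Un_le)
  also have "card {F \<in> nsets {1..n} k. Y \<subseteq> F} = (n - (t + 1)) choose (k - (t + 1))"
    using card_nsets_superset[of "{1..n}" Y k] Y k by (simp add: nsets_def)
  finally show ?thesis using unc by simp
qed

text \<open>\<open>F\<close> has at most \<open>t\<close> points in \<open>Z\<close>, so some
  \<open>t\<close>-set \<open>S \<subseteq> Z\<close> contains \<open>F \<inter> Z\<close>. A
  Frankl-type member \<open>E\<close> missing \<open>c \<in> S\<close> has at most
  \<open>t - 1\<close> points of \<open>F\<close> inside \<open>Z\<close>, so it contains a point
  \<open>v\<close> of \<open>F - Z\<close>. There are at most \<open>t * k\<close> pairs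
  \<open>(c, v)\<close>, and each fixes the trace of \<open>E\<close> on
  \<open>insert v Z\<close>.\<close>

lemma diversity_le_of_outlier:
  assumes G: "\<G> \<subseteq> nsets {1..n} k" and k: "t + 2 \<le> k" and t: "0 < t"
    and Z: "Z \<in> nsets {1..n} (t + 2)"
    and F: "F \<in> nsets {1..n} k" "F \<notin> frankl_on n k t Z"
    and int: "\<And>E. E \<in> \<G> \<Longrightarrow> t \<le> card (F \<inter> E)"
    and rest: "card (\<G> - frankl_on n k t Z) \<le> r"
  shows "diversity n t \<G> \<le> r + t * k * ((n - (t + 3)) choose (k - (t + 2)))"
proof -
  have Z': "finite Z" "card Z = t + 2" "Z \<subseteq> {1..n}" using Z by (auto simp: nsets_def)
  have F': "finite F" "card F = k" "F \<subseteq> {1..n}" using F by (auto simp: nsets_def)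
  have fin: "finite (nsets {1..n} k)" by (simp add: finite_imp_finite_nsets)
  then have fG: "finite \<G>" using G finite_subset by blast
  have "card (Z - F) = t + 2 - card (F \<inter> Z)"
    using Z' by (simp add: card_Diff_subset_Int Int_commute)
  moreover have "card (F \<inter> Z) \<le> t" using F by (simp add: frankl_on_def)
  ultimately have "2 \<le> card (Z - F)" by simp
  then obtain D where D: "D \<subseteq> Z - F" "card D = 2" "finite D"
    using obtain_subset_with_card_n[of 2 "Z - F"] by auto
  define S where "S = Z - D"
  have "card S = card Z - card D" unfolding S_def using D by (intro card_Diff_subset) auto
  then have S: "S \<subseteq> Z" "finite S" "card S = t" "F \<inter> Z \<subseteq> S"
    using D Z' by (auto simp: S_def)
  let ?L = "\<lambda>(c, v). {E \<in> nsets {1..n} k. E \<inter> insert v Z = insert v (Z - {c})}"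
  let ?I = "S \<times> (F - Z)"
  have fI: "finite ?I" using S F' by simp
  have "diversity n t \<G> \<le> card {E \<in> \<G>. \<not> S \<subseteq> E}"
    using fG S Z' by (intro diversity_le) (auto simp: nsets_def)
  also have "\<dots> \<le> card ((\<G> - frankl_on n k t Z) \<union> (\<Union>p\<in>?I. ?L p))"
  proof (rule card_mono)
    show "{E \<in> \<G>. \<not> S \<subseteq> E} \<subseteq> (\<G> - frankl_on n k t Z) \<union> (\<Union>p\<in>?I. ?L p)"
    proof
      fix E assume E: "E \<in> {E \<in> \<G>. \<not> S \<subseteq> E}"
      show "E \<in> (\<G> - frankl_on n k t Z) \<union> (\<Union>p\<in>?I. ?L p)"
      proof (cases "E \<in> frankl_on n k t Z")
        case True
        obtain c where c: "c \<in> S" "c \<notin> E" using E by blast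
        have EZ: "E \<inter> Z = Z - {c}"
          using Int_eq_Diff_singleton[OF Z'(1,2), of E c] True c S(1) by (auto simp: frankl_on_def)
        have "\<not> F \<inter> E \<subseteq> S - {c}"
        proof
          assume "F \<inter> E \<subseteq> S - {c}"
          then have "card (F \<inter> E) \<le> card (S - {c})" using S(2) by (intro card_mono) auto
          moreover have "card (S - {c}) < t" using S c t by simp
          moreover have "t \<le> card (F \<inter> E)" using E by (intro int) simp
          ultimately show False by linarith
        qed
        then obtain v where v: "v \<in> F" "v \<in> E" "v \<notin> S - {c}" by blast
        then have "v \<notin> Z" using S(4) c by blast
        moreover have "E \<inter> insert v Z = insert v (Z - {c})" using v(2) EZ by blast
        moreover have "E \<in> nsets {1..n} k" using E G by blast
        ultimately show ?thesis using c(1) v(1) by blast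
      qed (use E in simp)
    qed
  qed (use fG fI fin in auto)
  also have "\<dots> \<le> card (\<G> - frankl_on n k t Z) + card (\<Union>p\<in>?I. ?L p)" by (rule card_Un_le)
  also have "card (\<Union>p\<in>?I. ?L p) \<le> (\<Sum>p\<in>?I. card (?L p))" by (rule card_UN_le[OF fI])
  also have "\<dots> = (\<Sum>p\<in>?I. (n - (t + 3)) choose (k - (t + 2)))"
  proof (rule sum.cong)
    fix p assume "p \<in> ?I"
    then obtain c v where p: "p = (c, v)" "c \<in> Z" "v \<in> F" "v \<notin> Z" using S(1) by blast
    have cards: "card (insert v (Z - {c})) = t + 2" "card (insert v Z) = t + 3"
      using Z' p by simp_all
    have "insert v Z \<subseteq> {1..n}" "insert v (Z - {c}) \<subseteq> insert v Z" using Z' F' p by blast+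
    from card_nsets_Int_eq[OF finite_atLeastAtMost this, of k]
    show "card (?L p) = (n - (t + 3)) choose (k - (t + 2))"
      unfolding cards p(1) using k by simp
  qed simp
  also have "\<dots> = t * card (F - Z) * ((n - (t + 3)) choose (k - (t + 2)))"
    using S by (simp add: card_cartesian_product)
  also have "\<dots> \<le> t * k * ((n - (t + 3)) choose (k - (t + 2)))"
    using F' card_mono[of F "F - Z"] by (intro mult_le_mono1 mult_le_mono2) auto
  finally show ?thesis using rest by simp
qed

text \<open>A member containing a generator has the \<open>t + 1\<close> points of that generator in
  \<open>Z\<close>, so only uncovered members can fall outside.\<close>

lemma card_diff_frankl_on_le:
  assumes G: "\<G> \<subseteq> nsets {1..n} k" and B: "\<B> \<subseteq> nsets Z (t + 1)" and Z: "finite Z"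
    and unc: "card {F \<in> \<G>. \<forall>X\<in>\<B>. \<not> X \<subseteq> F} \<le> r"
  shows "card (\<G> - frankl_on n k t Z) \<le> r"
proof -
  have fG: "finite \<G>" using G finite_imp_finite_nsets[of "{1..n}"] finite_subset by blast
  have "\<G> - frankl_on n k t Z \<subseteq> {F \<in> \<G>. \<forall>X\<in>\<B>. \<not> X \<subseteq> F}"
  proof (intro subsetI CollectI conjI ballI notI)
    fix E X assume E: "E \<in> \<G> - frankl_on n k t Z" and X: "X \<in> \<B>" "X \<subseteq> E"
    have X': "X \<subseteq> Z" "card X = t + 1" using X(1) B by (auto simp: nsets_def)
    then have "card X \<le> card (E \<inter> Z)" using X(2) Z by (intro card_mono) auto
    then have "E \<in> frankl_on n k t Z" using E G X'(2) by (auto simp: frankl_on_def)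
    then show False using E by simp
  qed simp
  then have "card (\<G> - frankl_on n k t Z) \<le> card {F \<in> \<G>. \<forall>X\<in>\<B>. \<not> X \<subseteq> F}"
    using fG by (intro card_mono) auto
  then show ?thesis using unc by simp
qed

theorem theorem1p10:
  fixes n k t :: nat and \<F> \<G> :: "nat set set"
  assumes "2 \<le> t" and "t + 2 \<le> k"
    and "real n \<ge> real t + (real k - real t) * max (18 * (real t + 2)) (2 * exp 1 * real k)"
    and "\<F> \<subseteq> nsets {1..n} k" and "\<G> \<subseteq> nsets {1..n} k"
    and "cross_intersecting t \<F> \<G>"
  shows "min (diversity n t \<F>) (diversity n t \<G>) \<le> diversity n t (frankl n k t) \<and>
    (min (diversity n t \<F>) (diversity n t \<G>) = diversity n t (frankl n k t) \<longrightarrow>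
      (\<exists>Z \<in> nsets {1..n} (t + 2). \<F> \<subseteq> frankl_on n k t Z \<and> \<G> \<subseteq> frankl_on n k t Z))"
proof -
  define y where "y = (n - (t + 2)) choose (k - (t + 1))"
  define r where "r = peel_bound n k t 1"
  note num = peel_bound_estimates[OF assms(1-3), folded y_def r_def]
  have n: "t + 2 \<le> n" using num(1) assms(2) by simp
  \<comment> \<open>All upper bounds below are compared with \<open>t * y\<close>, so the Frankl
    family enters through a lower bound.\<close>
  have frankl: "t * y \<le> diversity n t (frankl n k t)"
  proof -
    have Z: "{1..t + 2} \<in> nsets {1..n} (t + 2)" using n by (auto simp: nsets_def)
    have "finite (frankl n k t)"
      by (simp add: frankl_def frankl_on_def finite_imp_finite_nsets)
    then obtain S where "S \<in> nsets {1..n} t"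
      "diversity n t (frankl n k t) = card {F \<in> frankl n k t. \<not> S \<subseteq> F}"
      using diversity_attained[of "frankl n k t" t n] n by auto
    then show ?thesis
      using card_frankl_on_missing_ge[OF Z _ assms(2) num(4)[unfolded y_def]]
      by (simp add: frankl_def y_def)
  qed
  have "t \<le> k" "1 \<le> k - t" using assms(2) by simp_all
  note peel[OF finite_atLeastAtMost assms(4-6) this, unfolded card_atLeastAtMost diff_Suc_1, folded r_def]
  then obtain \<A> \<B> where AB: "\<forall>X\<in>\<A>. X \<subseteq> {1..n} \<and> card X \<le> t + 1"
    "\<forall>X\<in>\<B>. X \<subseteq> {1..n} \<and> card X \<le> t + 1" "cross_intersecting t \<A> \<B>"
    and uncF: "card {F \<in> \<F>. \<forall>X\<in>\<A>. \<not> X \<subseteq> F} \<le> r"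
    and uncG: "card {F \<in> \<G>. \<forall>X\<in>\<B>. \<not> X \<subseteq> F} \<le> r"
    by (elim exE conjE)
  have k1: "t + 1 \<le> k" using assms(2) by simp
  \<comment> \<open>A strict inequality makes the equality clause vacuous, so equality survives only
    when both families lie in \<open>frankl_on n k t Z\<close>.\<close>
  have strict: ?thesis if "min (diversity n t \<F>) (diversity n t \<G>) < t * y"
    using that frankl by linarith
  from AB finite_atLeastAtMost show ?thesis
  proof (rule cross_intersecting_Suc_cases)
    show "t + 1 \<le> card {1..n}" using n by simp
  next
    fix S Y assume "S \<in> nsets {1..n} t" "Y \<in> nsets {1..n} (t + 1)" "\<forall>X\<in>\<A>. \<not> S \<subseteq> X \<longrightarrow> X = Y"
    from diversity_le_of_uncovered[OF assms(4) k1 this uncF] show ?thesis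
      using num(2) by (intro strict) linarith
  next
    fix S Y assume "S \<in> nsets {1..n} t" "Y \<in> nsets {1..n} (t + 1)" "\<forall>X\<in>\<B>. \<not> S \<subseteq> X \<longrightarrow> X = Y"
    from diversity_le_of_uncovered[OF assms(5) k1 this uncG] show ?thesis
      using num(2) by (intro strict) linarith
  next
    fix Z assume Z: "Z \<in> nsets {1..n} (t + 2)" "\<A> \<subseteq> nsets Z (t + 1)" "\<B> \<subseteq> nsets Z (t + 1)"
    have fZ: "finite Z" using Z(1) by (simp add: nsets_def)
    have t0: "0 < t" using assms(1) by simp
    show ?thesis
    proof (cases "\<F> \<subseteq> frankl_on n k t Z \<and> \<G> \<subseteq> frankl_on n k t Z")
      case True
      then have "diversity n t \<F> \<le> t * y"
        using diversity_frankl_on_subset_le[OF _ Z(1) k1] by (simp add: y_def)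
      then show ?thesis using True Z(1) frankl by (auto simp: min_def)
    next
      case False
      \<comment> \<open>A member of one family outside the Frankl family on \<open>Z\<close> bounds
        the diversity of the other family, which suffices for the minimum.\<close>
      then consider F where "F \<in> \<F>" "F \<notin> frankl_on n k t Z" | F where "F \<in> \<G>" "F \<notin> frankl_on n k t Z"
        by blast
      then show ?thesis
      proof cases
        case 1
        have "diversity n t \<G> \<le> r + t * k * ((n - (t + 3)) choose (k - (t + 2)))"
          using 1 assms(4,6)
          by (intro diversity_le_of_outlier[OF assms(5,2) t0 Z(1) _ 1(2) _
                card_diff_frankl_on_le[OF assms(5) Z(3) fZ uncG]])
            (auto simp: cross_intersecting_def)
        then show ?thesis using num(3) by (intro strict) linarith
      next
        case 2
        have "diversity n t \<F> \<le> r + t * k * ((n - (t + 3)) choose (k - (t + 2)))"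
          using 2 assms(5) cross_intersecting_sym[OF assms(6)]
          by (intro diversity_le_of_outlier[OF assms(4,2) t0 Z(1) _ 2(2) _
                card_diff_frankl_on_le[OF assms(4) Z(2) fZ uncF]])
            (auto simp: cross_intersecting_def)
        then show ?thesis using num(3) by (intro strict) linarith
      qed
    qed
  qed
qed

end
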